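(* Let $0<p_0<p_1\le\infty$, $0<q_0,q_1\le\infty$, $0<r_1\le r_0\le\infty$ and $\beta_0,\beta_1\in\mathbb{R}$ satisfy $\beta_0-\beta_1=\frac{d}{p_0}-\frac{d}{p_1}$. Then there is the continuous embedding $$\mathrm T^{p_0,q_0,r_0}_{\beta_0}\hookrightarrow\mathrm T^{p_1,q_1,r_1}_{\beta_1}.$$
   Context: The symbol ⨍ denotes the mean-value integral and $B(x,t)$ the open ball in $\mathbb{R}^d$; $\mathbb{R}^{d+1}_+=(0,\infty)\times\mathbb{R}^d$. For $0<r\le\infty$, $\beta\in\mathbb{R}$ and measurable $f$ on $\mathbb{R}^{d+1}_+$ write $W_{r,\beta}f(t,x)=\big(⨍_{t/2}^t⨍_{B(x,t)}|s^{-\beta}f(s,y)|^r\,\mathrm{d}y\,\mathrm{d}s\big)^{1/r}$ (essential supremum of $|s^{-\beta}f(s,y)|$ over $(\frac t2,t]\times B(x,t)$ if $r=\infty$). For $0<p,q,r\le\infty$ the tent space $\mathrm T^{p,q,r}_\beta$ is the set of measurable $f$ with finite (quasi-)norm, where $$\|f\|_{\mathrm T^{p,q,r}_\beta}=\Big\|\Big(\int_0^\infty (W_{r,\beta}f(t,\cdot))^q\frac{\mathrm{d}t}{t}\Big)^{1/q}\Big\|_{L^p(\mathbb{R}^d)}\quad(p<\infty),$$ with $\operatorname{ess\,sup}_{t>0}$ in place of the $t$-integral if $q=\infty$; $$\|f\|_{\mathrm T^{\infty,q,r}_\beta}=\sup_{\tau>0}\sup_{y\in\mathbb{R}^d}\Big(\int_0^\tau⨍_{B(y,\tau)}(W_{r,\beta}f(t,x))^q\frac{\mathrm{d}x\,\mathrm{d}t}{t}\Big)^{1/q}\quad(q<\infty),\qquad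 \|f\|_{\mathrm T^{\infty,\infty,r}_\beta}=\sup_{t>0}\sup_{x\in\mathbb{R}^d}W_{r,\beta}f(t,x).$$ *)

theory Defs
  imports "HOL-Analysis.Analysis" "HOL-Probability.Essential_Supremum"
begin

text \<open>
  Exponents in \<open>(0, \<infinity>]\<close> are values of type \<^typ>\<open>ennreal\<close>. All (quasi-)norms and
  averages are computed in \<^typ>\<open>ennreal\<close>, so that they are defined for every function.
\<close>

text \<open>Used for exponents \<open>a > 0\<close> only, with \<open>0\<^sup>a = 0\<close> and \<open>\<infinity>\<^sup>a = \<infinity>\<close>.\<close>

definition enn_powr :: "ennreal \<Rightarrow> real \<Rightarrow> ennreal" where
  "enn_powr x a = (if x = \<infinity> then \<infinity> else ennreal (enn2real x powr a))"

definition mean_value :: "'a::euclidean_space set \<Rightarrow> ('a \<Rightarrow> ennreal) \<Rightarrow> ennreal" where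
  "mean_value S g = (\<integral>\<^sup>+y\<in>S. g y \<partial>lebesgue) / emeasure lebesgue S"

definition half_space :: "(real \<times> (real^'n)) set" where
  "half_space = {0<..} \<times> UNIV"

definition whitney_mean ::
  "ennreal \<Rightarrow> real \<Rightarrow> (real \<times> (real^'n) \<Rightarrow> complex) \<Rightarrow> real \<Rightarrow> real^'n \<Rightarrow> ennreal" where
  "whitney_mean r \<beta> f t x =
    (if r = \<infinity>
     then esssup (lebesgue_on ({t/2<..t} \<times> ball x t))
            (\<lambda>(s, y). ennreal (norm (s powr (- \<beta>) *\<^sub>R f (s, y))))
     else enn_powr
            (mean_value {t/2..t} (\<lambda>s. mean_value (ball x t)
               (\<lambda>y. enn_powr (ennreal (norm (s powr (- \<beta>) *\<^sub>R f (s, y)))) (enn2real r))))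
            (1 / enn2real r))"

definition tent_norm ::
  "ennreal \<Rightarrow> ennreal \<Rightarrow> ennreal \<Rightarrow> real \<Rightarrow> (real \<times> (real^'n) \<Rightarrow> complex) \<Rightarrow> ennreal" where
  "tent_norm p q r \<beta> f =
    (if p = \<infinity> then
       (if q = \<infinity> then (SUP t\<in>{0<..}. SUP x. whitney_mean r \<beta> f t x)
        else (SUP \<tau>\<in>{0<..}. SUP y. enn_powr
               (\<integral>\<^sup>+t\<in>{0<..<\<tau>}.
                  mean_value (ball y \<tau>) (\<lambda>x. enn_powr (whitney_mean r \<beta> f t x) (enn2real q)) / ennreal t
                \<partial>lebesgue)
               (1 / enn2real q)))
     else enn_powr
       (\<integral>\<^sup>+x. enn_powr
          (if q = \<infinity> then esssup (lebesgue_on {0<..}) (\<lambda>t. whitney_mean r \<beta> f t x)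
           else enn_powr
             (\<integral>\<^sup>+t\<in>{0<..}. enn_powr (whitney_mean r \<beta> f t x) (enn2real q) / ennreal t \<partial>lebesgue)
             (1 / enn2real q))
          (enn2real p) \<partial>lebesgue)
       (1 / enn2real p))"

text \<open>
  Elements are functions rather than classes modulo equality almost everywhere, and only
  their values on the half space matter.
\<close>

definition tent_space ::
  "ennreal \<Rightarrow> ennreal \<Rightarrow> ennreal \<Rightarrow> real \<Rightarrow> (real \<times> (real^'n) \<Rightarrow> complex) set" where
  "tent_space p q r \<beta> =
    {f \<in> borel_measurable (lebesgue_on half_space). tent_norm p q r \<beta> f < \<infinity>}"

end

(*
  Write W for the Whitney mean with parameters (r0, beta0) and N for the inner functional of the norm
  of T^{p0,q0,r0}_{beta0}, so that N lies in L^{p0}. A piece of the Whitney box at (t, x) carrying a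
  fixed proportion of the mean lies in the boxes at all (s, z) with s in an interval of length
  comparable to t and z in a ball B(w, t/4) with |w - x| <= t. Hence W(t, x) is at most a constant
  times N on B(w, t/4), and a Vitali covering argument yields P with integral G bounded by a multiple
  of the integral of N^{p0} and W(t, x)^{p0} <= P(z) for all z in B(x, t).

  This gives W(t, x) <= P(x)^{1/p0} and, averaging over B(x, t), W(t, x) <= c (t^{-d} G)^{1/p0}. As
  W_{r1,beta1} is at most a constant times t^{beta0 - beta1} W, the first bound is integrable against
  dt/t near t = 0 and, for p1 finite, the second one near infinity. Splitting at t^d = G/P(x) bounds
  the inner functional of the target norm by P(x)^{1/p1} G^{1/p0 - 1/p1}, whose L^{p1} norm is
  G^{1/p0}. For p1 infinite the two bounds are inserted into the Carleson averages.
*)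

theory Submission
  imports Defs
begin

section \<open>Powers and integrals of extended nonnegative numbers\<close>

text \<open>The power \<open>p0\<close> is therefore taken before integrating: only measures of
  superlevel sets are compared, and everything afterwards uses one integrable function
  \<open>P\<close>, whatever \<open>p0\<close> is. The passage from \<open>P\<close> to a finite
  \<open>p1\<close> is Hedberg's argument: with \<open>\<delta> = d/p0 - d/p1\<close>, a growing
  bound \<open>t^\<delta> P(x)^(1/p0)\<close> competes with a decaying bound
  \<open>t^(-d/p1) G^(1/p0)\<close>, and the scale-invariant measure \<open>dt/t\<close> returns a
  multiple of their common value at the crossover. The condition \<open>p0 < p1\<close> enters as
  \<open>\<delta> > 0\<close>. The decay disappears for \<open>p1 = \<infinity>\<close>, which is
  why that case is separate. The second obstacle is measurability: \<open>f\<close> is only Lebesgue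
  measurable, the inner functional of the source norm is not shown to be measurable in
  \<open>x\<close>, and \<open>esssup\<close> is \<open>top\<close> on nonmeasurable functions.
  Hence the Borel representatives, the lower semicontinuous \<open>P\<close> and the explicit
  measurability in \<open>t\<close>.\<close>

lemma enn_powr_mono: "x \<le> y \<Longrightarrow> 0 \<le> a \<Longrightarrow> enn_powr x a \<le> enn_powr y a"
  by (auto simp: enn_powr_def top_unique less_top intro!: ennreal_leI powr_mono2 enn2real_mono)

lemma enn_powr_ennreal: "0 \<le> x \<Longrightarrow> enn_powr (ennreal x) a = ennreal (x powr a)"
  by (simp add: enn_powr_def)

lemma enn_powr_top [simp]: "enn_powr top a = top"
  by (simp add: enn_powr_def)

lemma enn_powr_one [simp]: "enn_powr x 1 = x"
  by (simp add: enn_powr_def less_top)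

lemma enn_powr_powr: "enn_powr (enn_powr x a) b = enn_powr x (a * b)"
  by (simp add: enn_powr_def powr_powr)

lemma enn_powr_eq_0_iff [simp]: "enn_powr x a = 0 \<longleftrightarrow> x = 0"
  by (cases x) (auto simp: enn_powr_def)

lemma enn_powr_mult:
  assumes "0 < a" shows "enn_powr (x * y) a = enn_powr x a * enn_powr y a"
proof (cases "x = top \<or> y = top")
  case True
  then show ?thesis
    by (cases "x = 0"; cases "y = 0") (auto simp: ennreal_mult_eq_top_iff top_unique
      ennreal_top_mult ennreal_mult_top)
next
  case False
  then obtain u v where uv: "x = ennreal u" "y = ennreal v" "0 \<le> u" "0 \<le> v"
    by (cases x; cases y) auto
  have "enn_powr (x * y) a = enn_powr (ennreal (u * v)) a"
    using uv by (simp add: ennreal_mult)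
  also have "\<dots> = ennreal (u powr a * v powr a)"
    using uv by (subst enn_powr_ennreal) (auto simp: powr_mult)
  also have "\<dots> = enn_powr x a * enn_powr y a"
    using uv by (simp add: enn_powr_ennreal ennreal_mult)
  finally show ?thesis .
qed

lemma enn_powr_le_iff:
  assumes "0 < a" shows "enn_powr x a \<le> y \<longleftrightarrow> x \<le> enn_powr y (1 / a)"
proof
  assume "enn_powr x a \<le> y"
  from enn_powr_mono[OF this, of "1 / a"] assms show "x \<le> enn_powr y (1 / a)"
    by (simp add: enn_powr_powr)
next
  assume "x \<le> enn_powr y (1 / a)"
  from enn_powr_mono[OF this, of a] assms show "enn_powr x a \<le> y"
    by (simp add: enn_powr_powr)
qed

lemma borel_measurable_enn_powr [measurable (raw)]:
  assumes [measurable]: "f \<in> borel_measurable M"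
  shows "(\<lambda>x. enn_powr (f x) a) \<in> borel_measurable M"
  unfolding enn_powr_def by measurable

text \<open>Tonelli for the region under the graph of \<open>P\<close>. It lets a comparison of
  superlevel sets pass to the integrals.\<close>

lemma nn_integral_layer_cake:
  fixes P :: "'a \<Rightarrow> ennreal"
  assumes "sigma_finite_measure M" and P [measurable]: "P \<in> borel_measurable M"
  shows "(\<integral>\<^sup>+x. P x \<partial>M) =
    (\<integral>\<^sup>+l\<in>{0<..}. emeasure M {x \<in> space M. ennreal l < P x} \<partial>lborel)"
proof -
  interpret sigma_finite_measure M by fact
  interpret pair_sigma_finite M lborel ..
  have eq: "emeasure lborel {l. 0 < l \<and> ennreal l < p} = p" for p :: ennreal
  proof (cases p)
    case (real r)
    then have "{l. 0 < l \<and> ennreal l < p} = {0<..<r}"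
      by (auto simp: ennreal_less_iff)
    with real show ?thesis by simp
  next
    case top
    have "of_nat n \<le> emeasure lborel {0::real<..}" for n
    proof -
      have "{0<..<real n} \<subseteq> {0<..}" by auto
      from emeasure_mono[OF this, of lborel] show ?thesis
        by (simp add: ennreal_of_nat_eq_real_of_nat)
    qed
    then have "(SUP n. of_nat n) \<le> emeasure lborel {0::real<..}"
      by (intro SUP_least)
    then have "emeasure lborel {0::real<..} = top"
      by (simp add: ennreal_SUP_of_nat_eq_top top_unique)
    moreover have "{l. 0 < l \<and> ennreal l < p} = {0<..}" using top by auto
    ultimately show ?thesis using top by simp
  qed
  have "(\<integral>\<^sup>+x. P x \<partial>M) = (\<integral>\<^sup>+x. emeasure lborel {l. 0 < l \<and> ennreal l < P x} \<partial>M)"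
    by (simp add: eq)
  also have "\<dots> = (\<integral>\<^sup>+x. \<integral>\<^sup>+l. indicator {p. 0 < snd p \<and> ennreal (snd p) < P (fst p)} (x, l) \<partial>lborel \<partial>M)"
  proof (rule nn_integral_cong)
    fix x
    have "(\<integral>\<^sup>+l. indicator {p. 0 < snd p \<and> ennreal (snd p) < P (fst p)} (x, l) \<partial>lborel)
      = (\<integral>\<^sup>+l. indicator {l. 0 < l \<and> ennreal l < P x} l \<partial>lborel)"
      by (intro nn_integral_cong) (auto split: split_indicator)
    also have "\<dots> = emeasure lborel {l. 0 < l \<and> ennreal l < P x}"
      by (rule nn_integral_indicator) measurable
    finally show "emeasure lborel {l. 0 < l \<and> ennreal l < P x} =
      (\<integral>\<^sup>+l. indicator {p. 0 < snd p \<and> ennreal (snd p) < P (fst p)} (x, l) \<partial>lborel)" ..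
  qed
  also have "\<dots> = (\<integral>\<^sup>+l. \<integral>\<^sup>+x. indicator {p. 0 < snd p \<and> ennreal (snd p) < P (fst p)} (x, l) \<partial>M \<partial>lborel)"
    by (rule Fubini'[symmetric]) (simp, measurable)
  also have "\<dots> = (\<integral>\<^sup>+l\<in>{0<..}. emeasure M {x \<in> space M. ennreal l < P x} \<partial>lborel)"
  proof (rule nn_integral_cong)
    fix l :: real
    have "(\<integral>\<^sup>+x. indicator {p. 0 < snd p \<and> ennreal (snd p) < P (fst p)} (x, l) \<partial>M)
        = (\<integral>\<^sup>+x. indicator {0<..} l * indicator {x \<in> space M. ennreal l < P x} x \<partial>M)"
      by (intro nn_integral_cong) (auto split: split_indicator)
    also have "\<dots> = emeasure M {x \<in> space M. ennreal l < P x} * indicator {0<..} l"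
      by (subst nn_integral_cmult_indicator) (auto simp: mult.commute)
    finally show "(\<integral>\<^sup>+x. indicator {p. 0 < snd p \<and> ennreal (snd p) < P (fst p)} (x, l) \<partial>M) =
      emeasure M {x \<in> space M. ennreal l < P x} * indicator {0<..} l" .
  qed
  finally show ?thesis .
qed

text \<open>The indicator of a union is at most the sum of the indicators. The bound is an integral
  over \<open>count_space I\<close> because the Vitali selection is a countable set of pairs, and
  the disjoint union it is compared with has its measure in the same form.\<close>

lemma emeasure_UN_countable_le:
  assumes M: "\<And>i. i \<in> I \<Longrightarrow> X i \<in> sets M" and I: "countable I"
  shows "emeasure M (\<Union>i\<in>I. X i) \<le> (\<integral>\<^sup>+i. emeasure M (X i) \<partial>count_space I)"
proof -
  have "emeasure M (\<Union>i\<in>I. X i) = (\<integral>\<^sup>+x. indicator (\<Union>i\<in>I. X i) x \<partial>M)"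
    using M I by (intro nn_integral_indicator[symmetric]) auto
  also have "\<dots> \<le> (\<integral>\<^sup>+x. \<integral>\<^sup>+i. (indicator (X i) x :: ennreal) \<partial>count_space I \<partial>M)"
  proof (rule nn_integral_mono)
    fix x
    show "indicator (\<Union>i\<in>I. X i) x \<le> (\<integral>\<^sup>+i. indicator (X i) x \<partial>count_space I :: ennreal)"
    proof (cases "x \<in> (\<Union>i\<in>I. X i)")
      case True
      then obtain j where j: "j \<in> I" "x \<in> X j" by auto
      then have "1 = (\<integral>\<^sup>+i. indicator {j} i \<partial>count_space I)"
        by (subst nn_integral_indicator) (auto simp: emeasure_count_space)
      also have "\<dots> \<le> (\<integral>\<^sup>+i. indicator (X i) x \<partial>count_space I)"
        using j by (intro nn_integral_mono) (auto split: split_indicator)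
      finally show ?thesis using True by simp
    qed simp
  qed
  also have "\<dots> = (\<integral>\<^sup>+i. \<integral>\<^sup>+x. indicator (X i) x \<partial>M \<partial>count_space I)"
    using M by (subst nn_integral_count_space_nn_integral[OF I]) auto
  also have "\<dots> = (\<integral>\<^sup>+i. emeasure M (X i) \<partial>count_space I)"
    using M by (intro nn_integral_cong) auto
  finally show ?thesis .
qed

section \<open>Non-tangential majorants\<close>

text \<open>
  Neither \<open>U\<close> nor \<open>N\<close> has to be measurable (the integral of \<open>N\<close> is then a lower integral): the
  proof compares the lower semicontinuous functions \<open>P\<close> and \<open>Q \<le> N\<close>, whose superlevel sets are
  unions of the balls \<open>B(x, t)\<close> and \<open>B(w, t/4)\<close> with \<open>U t x > l\<close>. As these balls are comparable, the
  Vitali covering lemma bounds the measure of the former by that of the latter.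
\<close>

lemma nontangential_majorant:
  fixes U :: "real \<Rightarrow> 'a::euclidean_space \<Rightarrow> ennreal" and N :: "'a \<Rightarrow> ennreal"
  assumes UN: "\<And>t x. 0 < t \<Longrightarrow> \<exists>w\<in>cball x t. \<forall>z\<in>ball w (t/4). U t x \<le> N z"
  obtains P :: "'a \<Rightarrow> ennreal" where "P \<in> borel_measurable borel"
    and "\<And>t x z. 0 < t \<Longrightarrow> z \<in> ball x t \<Longrightarrow> U t x \<le> P z"
    and "(\<integral>\<^sup>+x. P x \<partial>lborel) \<le> ennreal (25 ^ DIM('a)) * (\<integral>\<^sup>+x. N x \<partial>lborel)"
proof -
  let ?d = "DIM('a)"
  define v where "v = unit_ball_vol (real ?d)"
  have v: "0 < v" by (simp add: v_def)
  have ball: "emeasure lborel (ball (c::'a) r) = ennreal (v * r ^ ?d)" if "0 \<le> r" for c r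
    using that by (simp add: emeasure_ball v_def)
  obtain w where w: "\<And>t x. 0 < t \<Longrightarrow> w t x \<in> cball x t"
    and wN: "\<And>t x z. 0 < t \<Longrightarrow> z \<in> ball (w t x) (t/4) \<Longrightarrow> U t x \<le> N z"
    using UN by metis
  \<comment> \<open>\<open>P\<close> and \<open>Q\<close> are the least functions that dominate
    \<open>U t x\<close> on the full balls and on the small balls respectively.\<close>
  define P where "P z = (SUP p\<in>{p. 0 < fst p \<and> z \<in> ball (snd p) (fst p)}. U (fst p) (snd p))" for z
  define Q where "Q z = (SUP p\<in>{p. 0 < fst p \<and> z \<in> ball (w (fst p) (snd p)) (fst p/4)}. U (fst p) (snd p))" for z
  define K where "K l = {p. 0 < fst p \<and> l < U (fst p) (snd p)}" for l
  have setP: "{z. l < P z} = (\<Union>p\<in>K l. ball (snd p) (fst p))" for l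
    unfolding P_def K_def less_SUP_iff by force
  have setQ: "{z. l < Q z} = (\<Union>p\<in>K l. ball (w (fst p) (snd p)) (fst p/4))" for l
    unfolding Q_def K_def less_SUP_iff by force
  have [measurable]: "P \<in> borel_measurable borel" "Q \<in> borel_measurable borel"
    by (auto intro!: borel_measurableI_greater borel_open open_UN simp: setP setQ simp del: mem_ball)
  have QN: "Q z \<le> N z" for z
    unfolding Q_def by (rule SUP_least) (use wN in auto)
  have weak: "emeasure lborel {z. l < P z} \<le> ennreal (25 ^ ?d) * emeasure lborel {z. l < Q z}" for l
  proof (cases "emeasure lborel {z. l < Q z} = \<infinity>")
    case True
    then show ?thesis by (simp add: ennreal_mult_top)
  next
    case False
    then obtain m where m: "emeasure lborel {z. l < Q z} = ennreal m" "0 \<le> m"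
      by (cases "emeasure lborel {z. l < Q z}") auto
    \<comment> \<open>The covering lemma wants bounded radii. A small ball inside the superlevel set
      of \<open>Q\<close> has volume at most \<open>m\<close>, and a radius above 1 is at most its
      \<open>?d\<close>-th power because the dimension is positive.\<close>
    have small: "fst p / 4 \<le> max 1 (m / v)" if "p \<in> K l" for p
    proof -
      have p: "0 < fst p" using that by (simp add: K_def)
      have "emeasure lborel (ball (w (fst p) (snd p)) (fst p/4)) \<le> emeasure lborel {z. l < Q z}"
        unfolding setQ using that by (intro emeasure_mono) (auto intro!: borel_open)
      then have "v * (fst p/4) ^ ?d \<le> m"
        using p m v by (simp add: ball)
      then have *: "(fst p/4) ^ ?d \<le> m / v"
        using v by (simp add: field_simps)
      show ?thesis
      proof (cases "fst p/4 \<le> 1")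
        case False
        then have "fst p/4 \<le> (fst p/4) ^ ?d"
          by (intro self_le_power) auto
        with * show ?thesis by linarith
      qed linarith
    qed
    \<comment> \<open>The radii are enlarged from \<open>t\<close> to \<open>5/4 * t\<close> so that
      each ball contains its small ball, whose centre is within \<open>t\<close>. Disjointness of
      the selected balls then passes to the small ones.\<close>
    obtain C where C: "countable C" "C \<subseteq> K l"
      "pairwise (\<lambda>i j. disjnt (ball (snd i) (5/4 * fst i)) (ball (snd j) (5/4 * fst j))) C"
      "{z. l < P z} \<subseteq> (\<Union>p\<in>C. ball (snd p) (5 * (5/4 * fst p)))"
    proof (rule Vitali_covering_lemma_balls[where S = "{z. l < P z}" and K = "K l"
        and a = snd and r = "\<lambda>p. 5/4 * fst p" and B = "5 * max 1 (m / v)"])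
      show "{z. l < P z} \<subseteq> (\<Union>i\<in>K l. ball (snd i) (5/4 * fst i))"
        unfolding setP by (intro UN_mono subset_ball) (auto simp: K_def)
      show "0 < 5/4 * fst p \<and> 5/4 * fst p \<le> 5 * max 1 (m / v)" if "p \<in> K l" for p
        using small[OF that] that by (auto simp: K_def)
    qed
    have pos: "0 < fst p" if "p \<in> C" for p
      using that C(2) by (auto simp: K_def)
    have sub: "ball (w (fst p) (snd p)) (fst p/4) \<subseteq> ball (snd p) (5/4 * fst p)" if "p \<in> C" for p
    proof
      fix z assume "z \<in> ball (w (fst p) (snd p)) (fst p/4)"
      with w[OF pos[OF that], of "snd p"] show "z \<in> ball (snd p) (5/4 * fst p)"
        using dist_triangle[of "snd p" z "w (fst p) (snd p)"] by auto
    qed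
    have "emeasure lborel {z. l < P z} \<le> emeasure lborel (\<Union>p\<in>C. ball (snd p) (5 * (5/4 * fst p)))"
      using C by (intro emeasure_mono) auto
    also have "\<dots> \<le> (\<integral>\<^sup>+p. emeasure lborel (ball (snd p) (5 * (5/4 * fst p))) \<partial>count_space C)"
      using C by (intro emeasure_UN_countable_le) auto
    also have "\<dots> = (\<integral>\<^sup>+p. ennreal (25 ^ ?d) * emeasure lborel (ball (w (fst p) (snd p)) (fst p/4)) \<partial>count_space C)"
    proof (rule nn_integral_cong)
      fix p assume "p \<in> space (count_space C)"
      then have p: "0 < fst p" using pos by auto
      \<comment> \<open>Fivefold enlargement of the radius \<open>5/4 * t\<close>, measured against
        \<open>t/4\<close>, gives the ratio 25.\<close>
      have eq: "5 * (5/4 * fst p) = 25 * (fst p/4)" by simp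
      have "v * (25 * (fst p / 4)) ^ ?d = 25 ^ ?d * (v * (fst p / 4) ^ ?d)"
        unfolding power_mult_distrib by simp
      then show "emeasure lborel (ball (snd p) (5 * (5/4 * fst p))) =
          ennreal (25 ^ ?d) * emeasure lborel (ball (w (fst p) (snd p)) (fst p/4))"
        unfolding eq using p v by (subst (1 2) ball) (auto simp: ennreal_mult[symmetric])
    qed
    also have "\<dots> = ennreal (25 ^ ?d) * (\<integral>\<^sup>+p. emeasure lborel (ball (w (fst p) (snd p)) (fst p/4)) \<partial>count_space C)"
      by (rule nn_integral_cmult) simp
    also have "(\<integral>\<^sup>+p. emeasure lborel (ball (w (fst p) (snd p)) (fst p/4)) \<partial>count_space C)
      = emeasure lborel (\<Union>p\<in>C. ball (w (fst p) (snd p)) (fst p/4))"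
    proof (rule emeasure_UN_countable[symmetric])
      show "disjoint_family_on (\<lambda>p. ball (w (fst p) (snd p)) (fst p/4)) C"
        unfolding disjoint_family_on_def
      proof (intro ballI impI)
        fix p q assume "p \<in> C" "q \<in> C" "p \<noteq> q"
        with C(3) have "disjnt (ball (snd p) (5/4 * fst p)) (ball (snd q) (5/4 * fst q))"
          by (auto simp: pairwise_def)
        with sub[OF \<open>p \<in> C\<close>] sub[OF \<open>q \<in> C\<close>]
        show "ball (w (fst p) (snd p)) (fst p/4) \<inter> ball (w (fst q) (snd q)) (fst q/4) = {}"
          unfolding disjnt_def by blast
      qed
    qed (use C in auto)
    also have "ennreal (25 ^ ?d) * \<dots> \<le> ennreal (25 ^ ?d) * emeasure lborel {z. l < Q z}"
      using C(2) unfolding setQ by (intro mult_left_mono emeasure_mono UN_mono) (auto intro!: borel_open)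
    finally show ?thesis .
  qed
  have "(\<integral>\<^sup>+x. P x \<partial>lborel) = (\<integral>\<^sup>+l\<in>{0<..}. emeasure lborel {x. ennreal l < P x} \<partial>lborel)"
    by (subst nn_integral_layer_cake) (auto intro: lborel.sigma_finite_measure_axioms)
  also have "\<dots> \<le> (\<integral>\<^sup>+l. ennreal (25 ^ ?d) * (emeasure lborel {x. ennreal l < Q x} * indicator {0<..} l) \<partial>lborel)"
    by (intro nn_integral_mono) (use weak in \<open>auto split: split_indicator\<close>)
  also have "\<dots> = ennreal (25 ^ ?d) * (\<integral>\<^sup>+l\<in>{0<..}. emeasure lborel {x. ennreal l < Q x} \<partial>lborel)"
    by (rule nn_integral_cmult) measurable
  also have "(\<integral>\<^sup>+l\<in>{0<..}. emeasure lborel {x. ennreal l < Q x} \<partial>lborel) = (\<integral>\<^sup>+x. Q x \<partial>lborel)"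
    by (subst nn_integral_layer_cake) (auto intro: lborel.sigma_finite_measure_axioms)
  also have "\<dots> \<le> (\<integral>\<^sup>+x. N x \<partial>lborel)"
    by (intro nn_integral_mono QN)
  finally have int: "(\<integral>\<^sup>+x. P x \<partial>lborel) \<le> ennreal (25 ^ ?d) * (\<integral>\<^sup>+x. N x \<partial>lborel)"
    by (auto simp: mult_left_mono)
  show thesis
  proof (rule that[OF _ _ int])
    show "U t x \<le> P z" if "0 < t" "z \<in> ball x t" for t x z
      unfolding P_def by (rule SUP_upper2[of "(t, x)"]) (use that in auto)
  qed simp
qed

section \<open>Bounds from a majorant\<close>

lemma nn_integral_powr_from_0:
  assumes "0 < a" "0 \<le> A"
  shows "(\<integral>\<^sup>+t\<in>{0..A}. ennreal (t powr (a - 1)) \<partial>lborel) = ennreal (A powr a / a)"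
  using nn_integral_has_integral_lebesgue'[OF _ has_integral_powr_from_0[of "a - 1" A]] assms
  by simp

lemma nn_integral_powr_to_inf:
  assumes "0 < b" "0 < A"
  shows "(\<integral>\<^sup>+t\<in>{A..}. ennreal (t powr (- b - 1)) \<partial>lborel) = ennreal (A powr - b / b)"
  using nn_integral_has_integral_lebesgue'[OF _ has_integral_powr_to_inf[of "- b - 1" A]] assms
  by simp

text \<open>The functional in \<open>t\<close> inside \<open>tent_norm\<close> for a finite outer
  exponent, freed from Whitney means: it is bounded above on power-type functions for the target
  norm, and below on functions that are large on one interval for the source norm.\<close>

definition vertical :: "ennreal \<Rightarrow> (real \<Rightarrow> ennreal) \<Rightarrow> ennreal" where
  "vertical q V = (if q = \<infinity> then esssup (lebesgue_on {0<..}) V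
     else enn_powr (\<integral>\<^sup>+t\<in>{0<..}. enn_powr (V t) (enn2real q) / ennreal t \<partial>lebesgue) (1 / enn2real q))"

text \<open>Against \<open>dt/t\<close> the growing power is integrable up to \<open>A\<close> and
  the decaying one from \<open>A\<close> on. Scaling invariance of \<open>dt/t\<close> makes the
  result independent of \<open>A\<close>, so that \<open>A\<close> may later depend on the
  point.\<close>

lemma nn_integral_two_sided_power:
  assumes pos: "0 < q" "0 < \<delta>" "0 < e" "0 < A" "0 \<le> M"
    and V: "\<And>t. 0 < t \<Longrightarrow> V t \<le> ennreal (M * min ((t/A) powr \<delta>) ((t/A) powr - e))"
  shows "(\<integral>\<^sup>+t\<in>{0<..}. enn_powr (V t) q / ennreal t \<partial>lborel)
    \<le> ennreal (M powr q * (1 / (\<delta> * q) + 1 / (e * q)))"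
proof -
  let ?l = "\<lambda>t. ennreal (t powr (\<delta> * q - 1)) * indicator {0..A} t"
  let ?u = "\<lambda>t. ennreal (t powr (- (e * q) - 1)) * indicator {A..} t"
  let ?cl = "M powr q * A powr - (\<delta> * q)" and ?cu = "M powr q * A powr (e * q)"
  have "enn_powr (V t) q / ennreal t * indicator {0<..} t \<le> ennreal ?cl * ?l t + ennreal ?cu * ?u t" for t
  proof (cases "0 < t")
    case t: True
    have *: "enn_powr (V t) q / ennreal t \<le> ennreal ((M * (t/A) powr s) powr q / t)"
      if "min ((t/A) powr \<delta>) ((t/A) powr - e) \<le> (t/A) powr s" for s
    proof -
      have "V t \<le> ennreal (M * (t/A) powr s)"
        using V[OF t] that pos by (elim order_trans) (intro ennreal_leI mult_left_mono, auto)
      then have "enn_powr (V t) q \<le> enn_powr (ennreal (M * (t/A) powr s)) q"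
        using pos by (intro enn_powr_mono) auto
      then have "enn_powr (V t) q \<le> ennreal ((M * (t/A) powr s) powr q)"
        using pos by (subst (asm) enn_powr_ennreal) auto
      then have "enn_powr (V t) q / ennreal t \<le> ennreal ((M * (t/A) powr s) powr q) / ennreal t"
        by (rule divide_right_mono_ennreal)
      then show ?thesis
        using t by (simp add: divide_ennreal)
    qed
    have **: "(M * (t/A) powr s) powr q / t = M powr q * A powr - (s * q) * t powr (s * q - 1)" for s
      using t pos by (simp add: powr_mult powr_powr powr_divide powr_diff powr_minus field_simps)
    show ?thesis
    proof (cases "t \<le> A")
      case True
      have "enn_powr (V t) q / ennreal t \<le> ennreal ?cl * ?l t"
        using *[of \<delta>] **[of \<delta>] t True pos by (simp add: ennreal_mult)
      then show ?thesis using t by (auto intro: order_trans)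
    next
      case False
      have "enn_powr (V t) q / ennreal t \<le> ennreal ?cu * ?u t"
        using *[of "- e"] **[of "- e"] t False pos by (simp add: ennreal_mult)
      then show ?thesis using t False by (auto intro: order_trans)
    qed
  qed simp
  then have "(\<integral>\<^sup>+t\<in>{0<..}. enn_powr (V t) q / ennreal t \<partial>lborel) \<le>
      (\<integral>\<^sup>+t. ennreal ?cl * ?l t + ennreal ?cu * ?u t \<partial>lborel)"
    by (intro nn_integral_mono)
  also have "\<dots> = ennreal ?cl * (\<integral>\<^sup>+t. ?l t \<partial>lborel) + ennreal ?cu * (\<integral>\<^sup>+t. ?u t \<partial>lborel)"
    by (subst nn_integral_add) (auto simp: nn_integral_cmult)
  also have "\<dots> = ennreal ?cl * ennreal (A powr (\<delta> * q) / (\<delta> * q)) + ennreal ?cu * ennreal (A powr - (e * q) / (e * q))"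
    using pos by (simp add: nn_integral_powr_from_0 nn_integral_powr_to_inf del: ennreal_plus)
  also have "\<dots> = ennreal (?cl * (A powr (\<delta> * q) / (\<delta> * q)) + ?cu * (A powr - (e * q) / (e * q)))"
    using pos by (subst (1 2) ennreal_mult[symmetric], simp_all del: ennreal_plus)
      (subst ennreal_plus, simp_all)
  also have "?cl * (A powr (\<delta> * q) / (\<delta> * q)) + ?cu * (A powr - (e * q) / (e * q))
      = M powr q * (1 / (\<delta> * q) + 1 / (e * q))"
    using pos by (simp add: powr_minus field_simps)
  finally show ?thesis .
qed

text \<open>For \<open>q = \<infinity>\<close> the two-sided power never exceeds 1, but
  measurability has to be supplied, as \<open>esssup\<close> is \<open>top\<close> on nonmeasurable
  functions.\<close>

lemma vertical_two_sided_power: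
  assumes q: "0 < q" and pos: "0 < \<delta>" "0 < e"
  obtains C :: real where "0 < C"
    "\<And>A M V. 0 < A \<Longrightarrow> 0 \<le> M \<Longrightarrow>
       (\<And>t. 0 < t \<Longrightarrow> V t \<le> ennreal (M * min ((t/A) powr \<delta>) ((t/A) powr - e))) \<Longrightarrow>
       (q = \<infinity> \<Longrightarrow> V \<in> borel_measurable (lebesgue_on {0<..})) \<Longrightarrow>
       vertical q V \<le> ennreal (C * M)"
proof (cases "q = \<infinity>")
  case True
  have "vertical q V \<le> ennreal (1 * M)" if "0 < A" "0 \<le> M"
    and V: "\<And>t. 0 < t \<Longrightarrow> V t \<le> ennreal (M * min ((t/A) powr \<delta>) ((t/A) powr - e))"
    and meas: "V \<in> borel_measurable (lebesgue_on {0<..})" for A M V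
  proof -
    have "V t \<le> ennreal M" if t: "0 < t" for t
    proof -
      have "min ((t/A) powr \<delta>) ((t/A) powr - e) \<le> 1"
      proof (cases "t/A \<le> 1")
        case True
        then have "(t/A) powr \<delta> \<le> 1"
          using t \<open>0 < A\<close> pos by (intro powr_le1) auto
        then show ?thesis by simp
      next
        case False
        then have "(t/A) powr - e \<le> 1"
          using pos t \<open>0 < A\<close> powr_mono[of "- e" 0 "t/A"] by simp
        then show ?thesis by simp
      qed
      then have "M * min ((t/A) powr \<delta>) ((t/A) powr - e) \<le> M"
        using \<open>0 \<le> M\<close> by (rule mult_left_le)
      then show ?thesis
        using V[OF t] by (meson ennreal_leI order_trans)
    qed
    then show ?thesis
      using True meas by (auto simp: vertical_def intro!: esssup_I AE_I2)
  qed
  then show ?thesis using True by (intro that[of 1]) auto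
next
  case False
  define r where "r = enn2real q"
  have r: "0 < r" using q False by (auto simp: r_def enn2real_positive_iff less_top)
  define c where "c = 1 / (\<delta> * r) + 1 / (e * r)"
  have c: "0 < c" using r pos by (simp add: c_def add_pos_pos)
  have "vertical q V \<le> ennreal (c powr (1/r) * M)" if "0 < A" "0 \<le> M"
    and V: "\<And>t. 0 < t \<Longrightarrow> V t \<le> ennreal (M * min ((t/A) powr \<delta>) ((t/A) powr - e))" for A M V
  proof -
    have "vertical q V \<le> enn_powr (ennreal (M powr r * c)) (1/r)"
      unfolding vertical_def using False r
        nn_integral_two_sided_power[OF r pos \<open>0 < A\<close> \<open>0 \<le> M\<close> V]
      by (auto simp: nn_integral_completion r_def[symmetric] c_def intro!: enn_powr_mono)
    also have "\<dots> = ennreal ((M powr r * c) powr (1/r))"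
      using c by (intro enn_powr_ennreal) auto
    also have "(M powr r * c) powr (1/r) = c powr (1/r) * M"
      using c r \<open>0 \<le> M\<close> by (simp add: powr_mult powr_powr)
    finally show ?thesis .
  qed
  then show ?thesis using c by (intro that[of "c powr (1/r)"]) auto
qed

text \<open>Integrating the constant \<open>u\<close> over the ball costs at most the total integral
  of \<open>P\<close>. This is the source of all decay in \<open>t\<close>.\<close>

lemma majorant_size:
  fixes P :: "'a::euclidean_space \<Rightarrow> ennreal"
  assumes P: "P \<in> borel_measurable borel" and int: "(\<integral>\<^sup>+x. P x \<partial>lborel) \<le> ennreal g" and "0 \<le> g"
    and t: "0 < t" and U: "\<And>z. z \<in> ball x t \<Longrightarrow> u \<le> P z"
  shows "u \<le> ennreal (g / (unit_ball_vol (real DIM('a)) * t ^ DIM('a)))"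
proof -
  let ?v = "unit_ball_vol (real DIM('a)) * t ^ DIM('a)"
  have v: "0 < ?v" using t by simp
  have "u * ennreal ?v = (\<integral>\<^sup>+z. u * indicator (ball x t) z \<partial>lborel)"
    using t by (subst nn_integral_cmult_indicator) (auto simp: emeasure_ball)
  also have "\<dots> \<le> (\<integral>\<^sup>+z. P z \<partial>lborel)"
    using U by (intro nn_integral_mono) (auto split: split_indicator)
  also note int
  finally have le: "u * ennreal ?v \<le> ennreal g" .
  then have "u \<noteq> top"
    using v less_imp_neq[OF v] by (auto simp: ennreal_top_mult top_unique simp del: mult_eq_0_iff split: if_splits)
  then obtain r where r: "u = ennreal r" "0 \<le> r"
    by (cases u) auto
  with le v \<open>0 \<le> g\<close> have "r * ?v \<le> g"
    by (simp flip: ennreal_mult)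
  with v have "r \<le> g / ?v" by (simp add: pos_le_divide_eq)
  with r show ?thesis by (simp add: ennreal_leI)
qed

lemma majorant_power_bound:
  assumes U: "U \<le> ennreal X" and V: "V \<le> ennreal a * enn_powr U b" and "0 \<le> X" "0 \<le> a" "0 < b"
  shows "V \<le> ennreal (a * X powr b)"
proof -
  have "enn_powr U b \<le> ennreal (X powr b)"
    using enn_powr_mono[OF U, of b] assms by (simp add: enn_powr_ennreal)
  then have "V \<le> ennreal a * ennreal (X powr b)"
    using V by (meson mult_left_mono order_trans zero_le)
  then show ?thesis using assms by (simp add: ennreal_mult)
qed

text \<open>Hedberg's trick. At almost every \<open>x\<close> the bound on \<open>V t x\<close> is a
  two-sided power in \<open>t\<close>, and the \<open>p1\<close>-th power of its peak is a constant
  times \<open>P x\<close>. Being linear in \<open>P\<close>, it is controlled by the integral of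
  \<open>P\<close> alone.\<close>

lemma vertical_Lp_bound:
  fixes \<delta> e p0 p1 :: real and q :: ennreal
  assumes pos: "0 < \<delta>" "0 < p0" "0 < p1" "0 < q"
    and scale: "\<delta> = real DIM('a::euclidean_space) / p0 - real DIM('a) / p1"
  obtains C :: real where "0 < C"
    "\<And>(U :: real \<Rightarrow> 'a \<Rightarrow> ennreal) V P. P \<in> borel_measurable borel \<Longrightarrow>
       (\<And>t x z. 0 < t \<Longrightarrow> z \<in> ball x t \<Longrightarrow> U t x \<le> P z) \<Longrightarrow>
       (\<And>t x. 0 < t \<Longrightarrow> V t x \<le> ennreal (t powr \<delta>) * enn_powr (U t x) (1 / p0)) \<Longrightarrow>
       (\<And>x. q = \<infinity> \<Longrightarrow> (\<lambda>t. V t x) \<in> borel_measurable (lebesgue_on {0<..})) \<Longrightarrow>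
       enn_powr (\<integral>\<^sup>+x. enn_powr (vertical q (\<lambda>t. V t x)) p1 \<partial>lborel) (1 / p1)
         \<le> ennreal C * enn_powr (\<integral>\<^sup>+x. P x \<partial>lborel) (1 / p0)"
proof -
  define d where "d = real DIM('a)"
  have d: "0 < d" by (simp add: d_def)
  define e where "e = d / p1"
  have e: "0 < e" "\<delta> = d / p0 - e" using d pos scale by (auto simp: e_def d_def)
  define v where "v = unit_ball_vol d"
  have v: "0 < v" by (simp add: v_def d_def)
  \<comment> \<open>The bound for small \<open>t\<close> has constant 1, the one for large
    \<open>t\<close> carries the volume of the unit ball; \<open>c\<close> covers both.\<close>
  define c where "c = max 1 (v powr - (1 / p0))"
  have c: "1 \<le> c" "v powr - (1 / p0) \<le> c" "0 \<le> c" by (auto simp: c_def)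
  obtain C1 where C1: "0 < C1" and
    vert: "\<And>A M V. 0 < A \<Longrightarrow> 0 \<le> M \<Longrightarrow>
       (\<And>t. 0 < t \<Longrightarrow> V t \<le> ennreal (M * min ((t/A) powr \<delta>) ((t/A) powr - e))) \<Longrightarrow>
       (q = \<infinity> \<Longrightarrow> V \<in> borel_measurable (lebesgue_on {0<..})) \<Longrightarrow>
       vertical q V \<le> ennreal (C1 * M)"
    using vertical_two_sided_power[OF \<open>0 < q\<close> \<open>0 < \<delta>\<close> e(1)] by metis
  define C where "C = C1 * c"
  have C: "0 < C" using C1 c(1) by (simp add: C_def)
  have main: "enn_powr (\<integral>\<^sup>+x. enn_powr (vertical q (\<lambda>t. V t x)) p1 \<partial>lborel) (1 / p1)
         \<le> ennreal C * enn_powr (\<integral>\<^sup>+x. P x \<partial>lborel) (1 / p0)"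
    if P: "P \<in> borel_measurable borel"
      and U: "\<And>t x z. 0 < t \<Longrightarrow> z \<in> ball x t \<Longrightarrow> U t x \<le> P z"
      and V: "\<And>t x. 0 < t \<Longrightarrow> V t x \<le> ennreal (t powr \<delta>) * enn_powr (U t x) (1 / p0)"
      and meas: "\<And>x. q = \<infinity> \<Longrightarrow> (\<lambda>t. V t x) \<in> borel_measurable (lebesgue_on {0<..})"
    for U V :: "real \<Rightarrow> 'a \<Rightarrow> ennreal" and P
  proof (cases "(\<integral>\<^sup>+x. P x \<partial>lborel)")
    case top
    with C show ?thesis by (simp add: ennreal_mult_top)
  next
    case (real g)
    have P': "P \<in> borel_measurable lborel" using P by simp
    have fin: "AE x in lborel. P x \<noteq> top"
      using nn_integral_noteq_infinite[OF P'] real by simp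
    \<comment> \<open>For \<open>g = 0\<close> there is no crossover scale at points with
      \<open>P x > 0\<close>, but these form a null set.\<close>
    have zero: "AE x in lborel. g = 0 \<longrightarrow> P x = 0"
    proof (cases "g = 0")
      case True
      with real nn_integral_0_iff_AE[OF P'] show ?thesis by simp
    qed simp
    define K where "K = C powr p1 * g powr (p1 / p0 - 1)"
    have pointwise: "enn_powr (vertical q (\<lambda>t. V t x)) p1 \<le> ennreal K * P x"
      if "P x \<noteq> top" "g = 0 \<longrightarrow> P x = 0" for x
    proof -
      define X where "X = enn2real (P x)"
      have X: "P x = ennreal X" "0 \<le> X"
        using that by (auto simp: X_def less_top)
      \<comment> \<open>Up to the volume constant, \<open>M\<close> is the common value of the two
        bounds at the scale \<open>A\<close> introduced below.\<close>
      define M where "M = g powr (1 / p0 - 1 / p1) * X powr (1 / p1)"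
      have M: "0 \<le> M" by (simp add: M_def)
      have Vx: "V t x \<le> ennreal (t powr \<delta> * X powr (1 / p0))" if "0 < t" for t
        using U[of t x x] V[of t x] X pos that by (intro majorant_power_bound[of "U t x"]) auto
      have "vertical q (\<lambda>t. V t x) \<le> ennreal (C1 * (c * M))"
      proof (cases "X = 0")
        case True
        \<comment> \<open>\<open>V\<close> vanishes along this vertical line, so any scale will
          do.\<close>
        show ?thesis
        proof (rule vert[of 1])
          show "V t x \<le> ennreal (c * M * min ((t/1) powr \<delta>) ((t/1) powr - e))" if "0 < t" for t
            using Vx[OF that] True by simp
        qed (use M c meas in auto)
      next
        case False
        with X have X0: "0 < X" by simp
        with that X real have g: "0 < g" by (cases "g = 0") auto
        \<comment> \<open>The scale at which the two bounds \<open>t powr \<delta> * X powr (1 / p0)\<close> and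
          \<open>t powr - e * g powr (1 / p0)\<close> for \<open>V t x\<close> coincide.\<close>
        define A where "A = (g / X) powr (1 / d)"
        have A: "0 < A" using g X0 by (simp add: A_def)
        show ?thesis
        proof (rule vert[OF A])
          fix t :: real assume t: "0 < t"
          have "(t/A) powr \<delta> * M = t powr \<delta> * X powr (1 / p0)"
          proof -
            have "\<delta> / d = 1 / p0 - 1 / p1"
              using d pos by (simp add: e(2) e_def field_simps)
            then have "A powr \<delta> = (g / X) powr (1 / p0 - 1 / p1)"
              by (simp add: A_def powr_powr)
            also have "\<dots> = M / X powr (1 / p0)"
              using g X0 by (simp add: M_def powr_divide powr_diff field_simps)
            finally have "M = A powr \<delta> * X powr (1 / p0)"
              using X0 by simp
            then show ?thesis using t A by (simp add: powr_divide)
          qed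
          moreover have "t powr \<delta> * X powr (1 / p0) \<le> c * (t powr \<delta> * X powr (1 / p0))"
            using c mult_right_mono[of 1 c "t powr \<delta> * X powr (1 / p0)"] by simp
          ultimately have 1: "V t x \<le> ennreal (c * M * (t/A) powr \<delta>)"
            by (intro order_trans[OF Vx[OF t]] ennreal_leI) (metis mult.assoc mult.commute)
          \<comment> \<open>The decaying bound: the size estimate contributes
            \<open>t powr - (d / p0)\<close>, and the weight \<open>t powr \<delta>\<close> leaves
            \<open>t powr - e\<close>.\<close>
          have "U t x \<le> ennreal (g / (v * t ^ DIM('a)))"
            unfolding v_def d_def using real U t by (intro majorant_size[OF P]) auto
          then have "V t x \<le> ennreal (t powr \<delta> * (g / (v * t ^ DIM('a))) powr (1 / p0))"
            using V[OF t] pos g v t by (intro majorant_power_bound[of "U t x"]) auto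
          also have "t powr \<delta> * (g / (v * t ^ DIM('a))) powr (1 / p0)
              = v powr - (1 / p0) * (g powr (1 / p0) * t powr - e)"
          proof -
            have "t ^ DIM('a) = t powr d" using t by (simp add: d_def powr_realpow)
            then have "(g / (v * t ^ DIM('a))) powr (1 / p0) = v powr - (1 / p0) * g powr (1 / p0) * t powr - (d / p0)"
              using g v t by (simp add: powr_divide powr_mult powr_powr powr_minus field_simps)
            moreover have "t powr \<delta> * t powr - (d / p0) = t powr - e"
              by (simp add: e(2) powr_add[symmetric])
            ultimately show ?thesis by (simp add: mult_ac)
          qed
          also have "g powr (1 / p0) * t powr - e = M * (t/A) powr - e"
          proof -
            have "A powr e = (g / X) powr (1 / p1)"
              using d by (simp add: A_def powr_powr e_def)
            also have "\<dots> = g powr (1 / p0) / M"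
              using g X0 by (simp add: M_def powr_divide powr_diff field_simps)
            finally have "g powr (1 / p0) = A powr e * M"
              using g X0 by (simp add: M_def)
            then show ?thesis using t A by (simp add: powr_divide powr_minus field_simps)
          qed
          also have "ennreal (v powr - (1 / p0) * (M * (t/A) powr - e)) \<le> ennreal (c * M * (t/A) powr - e)"
            using c(2) M by (intro ennreal_leI) (simp add: mult.assoc mult_right_mono)
          finally have 2: "V t x \<le> ennreal (c * M * (t/A) powr - e)" .
          show "V t x \<le> ennreal (c * M * min ((t/A) powr \<delta>) ((t/A) powr - e))"
            using 1 2 by (simp add: min_def)
        qed (use M c meas in auto)
      qed
      then have "enn_powr (vertical q (\<lambda>t. V t x)) p1 \<le> enn_powr (ennreal (C * M)) p1"
        using pos by (intro enn_powr_mono) (auto simp: C_def mult.assoc)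
      also have "\<dots> = ennreal ((C * M) powr p1)"
        using C M by (intro enn_powr_ennreal) auto
      also have "(C * M) powr p1 = K * X"
      proof -
        have "M powr p1 = g powr (p1 / p0 - 1) * X"
          using pos X(2) by (simp add: M_def powr_mult powr_powr left_diff_distrib)
        then show ?thesis using C M by (simp add: K_def powr_mult)
      qed
      also have "ennreal (K * X) = ennreal K * P x"
        using X C by (simp add: K_def ennreal_mult)
      finally show ?thesis .
    qed
    have "(\<integral>\<^sup>+x. enn_powr (vertical q (\<lambda>t. V t x)) p1 \<partial>lborel) \<le> (\<integral>\<^sup>+x. ennreal K * P x \<partial>lborel)"
      using fin zero by (intro nn_integral_mono_AE) (auto intro: pointwise)
    also have "\<dots> = ennreal K * ennreal g"
      using P' real by (simp add: nn_integral_cmult)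
    also have "\<dots> = ennreal (K * g)"
      using real C by (simp add: K_def ennreal_mult)
    also have "K * g = C powr p1 * g powr (p1 / p0)"
      using real by (cases "g = 0") (simp_all add: K_def powr_diff)
    finally have "enn_powr (\<integral>\<^sup>+x. enn_powr (vertical q (\<lambda>t. V t x)) p1 \<partial>lborel) (1 / p1)
        \<le> enn_powr (ennreal (C powr p1 * g powr (p1 / p0))) (1 / p1)"
      using pos by (intro enn_powr_mono) auto
    also have "\<dots> = ennreal ((C powr p1 * g powr (p1 / p0)) powr (1 / p1))"
      by (intro enn_powr_ennreal) auto
    also have "(C powr p1 * g powr (p1 / p0)) powr (1 / p1) = C * g powr (1 / p0)"
      using C pos by (simp add: powr_mult powr_powr)
    also have "ennreal (C * g powr (1 / p0)) = ennreal C * enn_powr (\<integral>\<^sup>+x. P x \<partial>lborel) (1 / p0)"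
      using C real by (simp add: enn_powr_ennreal ennreal_mult)
    finally show ?thesis .
  qed
  show thesis by (rule that[OF C main])
qed

section \<open>The endpoint \<open>p1 = \<infinity>\<close>: uniform and Carleson bounds\<close>

lemma sup_bound:
  fixes U V :: "real \<Rightarrow> 'a::euclidean_space \<Rightarrow> ennreal"
  assumes p0: "0 < p0" and P: "P \<in> borel_measurable borel"
    and U: "\<And>t x z. 0 < t \<Longrightarrow> z \<in> ball x t \<Longrightarrow> U t x \<le> P z"
    and V: "\<And>t x. 0 < t \<Longrightarrow> V t x \<le> ennreal (t powr (real DIM('a) / p0)) * enn_powr (U t x) (1 / p0)"
    and t: "0 < t"
  shows "V t x \<le> ennreal (unit_ball_vol (real DIM('a)) powr - (1 / p0)) *
      enn_powr (\<integral>\<^sup>+x. P x \<partial>lborel) (1 / p0)"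
proof (cases "(\<integral>\<^sup>+x. P x \<partial>lborel)")
  case top
  \<comment> \<open>A vanishing constant would spoil this case, since
    \<open>0 * top = 0\<close>.\<close>
  have "unit_ball_vol (real DIM('a)) \<noteq> 0"
    by (metis less_irrefl of_nat_0_le_iff unit_ball_vol_pos)
  with top show ?thesis by (simp add: ennreal_mult_top)
next
  case (real g)
  let ?v = "unit_ball_vol (real DIM('a))" and ?d = "real DIM('a)"
  have v: "0 < ?v" by simp
  have "U t x \<le> ennreal (g / (?v * t ^ DIM('a)))"
    using real U t by (intro majorant_size[OF P]) auto
  then have "V t x \<le> ennreal (t powr (?d / p0) * (g / (?v * t ^ DIM('a))) powr (1 / p0))"
    using V[OF t] p0 real v t by (intro majorant_power_bound[of "U t x"]) auto
  \<comment> \<open>The weight cancels the decay of the size estimate exactly, so the bound no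
    longer depends on \<open>t\<close>.\<close>
  also have "t powr (?d / p0) * (g / (?v * t ^ DIM('a))) powr (1 / p0) = ?v powr - (1 / p0) * g powr (1 / p0)"
  proof -
    have "t ^ DIM('a) = t powr ?d" using t by (simp add: powr_realpow)
    then show ?thesis
      using real v t by (simp add: powr_divide powr_mult powr_powr powr_minus field_simps)
  qed
  finally show ?thesis
    using real by (simp add: enn_powr_ennreal ennreal_mult)
qed

text \<open>A substitute for Jensen's inequality on a region with average at most \<open>B\<close>, at the cost of a factor 2.\<close>

lemma powr_le_weighted:
  fixes u :: real
  assumes "0 < \<theta>" "\<theta> \<le> 1" "0 < B" "0 \<le> u"
  shows "u powr \<theta> \<le> B powr \<theta> + B powr (\<theta> - 1) * u"
proof (cases "u \<le> B")
  case True
  then have "u powr \<theta> \<le> B powr \<theta>"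
    using assms by (intro powr_mono2) auto
  then show ?thesis using assms by (simp add: add_increasing2)
next
  case False
  then have u: "0 < u" "B \<le> u" using assms by auto
  have "u powr \<theta> = u powr (\<theta> - 1) * u"
    using u by (simp add: powr_diff)
  also have "\<dots> \<le> B powr (\<theta> - 1) * u"
    using assms u by (intro mult_right_mono powr_mono2') auto
  finally show ?thesis by (simp add: add_increasing)
qed

text \<open>Neither bound suffices alone: the size estimate gives a constant in \<open>t\<close>,
  whose integral against \<open>dt/t\<close> diverges at 0, and the bound by \<open>P\<close> gives
  the power \<open>q / p0\<close> of \<open>P\<close>, which need not be locally integrable when
  \<open>q > p0\<close>. So \<open>u powr \<kappa>\<close> is split into
  \<open>u powr (\<kappa> - \<theta>)\<close>, which gets the size estimate, and
  \<open>u powr \<theta>\<close> with \<open>\<theta> \<le> 1\<close>, which is averaged by means of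
  \<open>P\<close>. The positive power \<open>d * \<theta>\<close> of \<open>t\<close> survives and
  is integrable against \<open>dt/t\<close> near 0.\<close>

lemma carleson_bound:
  fixes p0 q :: real
  assumes p0: "0 < p0" and q: "0 < q"
  obtains C :: real where "0 < C"
    "\<And>(U :: real \<Rightarrow> 'a::euclidean_space \<Rightarrow> ennreal) V P \<tau> y. P \<in> borel_measurable borel \<Longrightarrow>
       (\<And>t x z. 0 < t \<Longrightarrow> z \<in> ball x t \<Longrightarrow> U t x \<le> P z) \<Longrightarrow>
       (\<And>t x. 0 < t \<Longrightarrow>
         V t x \<le> ennreal (t powr (real DIM('a) / p0)) * enn_powr (U t x) (1 / p0)) \<Longrightarrow>
       0 < \<tau> \<Longrightarrow>
       enn_powr (\<integral>\<^sup>+t\<in>{0<..<\<tau>}. mean_value (ball y \<tau>) (\<lambda>x. enn_powr (V t x) q) / ennreal t \<partial>lborel) (1 / q)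
         \<le> ennreal C * enn_powr (\<integral>\<^sup>+x. P x \<partial>lborel) (1 / p0)"
proof -
  define d where "d = real DIM('a)"
  have d: "0 < d" by (simp add: d_def)
  define v where "v = unit_ball_vol d"
  have v: "0 < v" by (simp add: v_def d_def)
  define \<kappa> where "\<kappa> = q / p0"
  define \<theta> where "\<theta> = min 1 \<kappa>"
  have \<kappa>: "0 < \<kappa>" "0 < \<theta>" "\<theta> \<le> 1" "\<theta> \<le> \<kappa>" using p0 q by (auto simp: \<kappa>_def \<theta>_def)
  \<comment> \<open>\<open>L\<close> collects \<open>v powr (\<theta> - \<kappa>)\<close> from the
    size estimate, \<open>1 + 1 / v\<close> from the average over the ball and
    \<open>1 / (d * \<theta>)\<close> from the integral of
    \<open>t powr (d * \<theta> - 1)\<close>.\<close>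
  define L where "L = v powr (\<theta> - \<kappa>) * (1 + 1 / v) / (d * \<theta>)"
  have L: "0 < L" using v d \<kappa> by (simp add: L_def add_pos_pos)
  define C where "C = L powr (1 / q)"
  have C: "0 < C" using L by (simp add: C_def)
  have main: "enn_powr (\<integral>\<^sup>+t\<in>{0<..<\<tau>}. mean_value (ball y \<tau>) (\<lambda>x. enn_powr (V t x) q) / ennreal t \<partial>lborel) (1 / q)
         \<le> ennreal C * enn_powr (\<integral>\<^sup>+x. P x \<partial>lborel) (1 / p0)"
    if P: "P \<in> borel_measurable borel"
      and U: "\<And>t x z. 0 < t \<Longrightarrow> z \<in> ball x t \<Longrightarrow> U t x \<le> P z"
      and V: "\<And>t x. 0 < t \<Longrightarrow> V t x \<le> ennreal (t powr (real DIM('a) / p0)) * enn_powr (U t x) (1 / p0)"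
      and \<tau>: "0 < \<tau>"
    for U V :: "real \<Rightarrow> 'a \<Rightarrow> ennreal" and P \<tau> y
  proof (cases "(\<integral>\<^sup>+x. P x \<partial>lborel)")
    case top
    with C show ?thesis by (simp add: ennreal_mult_top)
  next
    case (real g)
    have P': "P \<in> borel_measurable lborel" using P by simp
    \<comment> \<open>The mean of \<open>P\<close> over a ball of radius \<open>\<tau>\<close> is at
      most \<open>B / v\<close>, so \<open>B\<close> is the natural level for
      \<open>powr_le_weighted\<close>. The factor \<open>a t\<close> is the dependence on
      \<open>t\<close> that remains after the size estimate.\<close>
    define B where "B = g / \<tau> powr d"
    define a where "a t = t powr (d * \<theta>) * (g / v) powr (\<kappa> - \<theta>)" for t
    have Vq: "enn_powr (V t x) q \<le> ennreal (a t) * (ennreal (B powr \<theta>) + ennreal (B powr (\<theta> - 1)) * P x)"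
      if t: "0 < t" for t x
    proof -
      have Ug: "U t x \<le> ennreal (g / (v * t ^ DIM('a)))"
        unfolding v_def d_def using real U t by (intro majorant_size[OF P]) auto
      also have "g / (v * t ^ DIM('a)) = (g / v) * t powr - d"
        using t by (simp add: d_def powr_realpow powr_minus field_simps)
      finally have Ug: "U t x \<le> ennreal ((g / v) * t powr - d)" .
      define u where "u = enn2real (U t x)"
      have u: "U t x = ennreal u" "0 \<le> u"
        using Ug le_less_trans[OF Ug ennreal_less_top] by (auto simp: u_def)
      have ug: "u \<le> (g / v) * t powr - d"
        using Ug u real v by simp
      have uP: "ennreal u \<le> P x"
        using U[of t x x] t u by simp
      have "V t x \<le> ennreal (t powr (d / p0) * u powr (1 / p0))"
        using V[OF t, of x] p0 u by (intro majorant_power_bound[of "U t x"]) (auto simp: d_def)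
      then have "enn_powr (V t x) q \<le> enn_powr (ennreal (t powr (d / p0) * u powr (1 / p0))) q"
        using q by (intro enn_powr_mono) auto
      also have "\<dots> = ennreal ((t powr (d / p0) * u powr (1 / p0)) powr q)"
        by (intro enn_powr_ennreal) auto
      also have "(t powr (d / p0) * u powr (1 / p0)) powr q = t powr (d * \<kappa>) * u powr \<kappa>"
        by (simp add: powr_mult powr_powr \<kappa>_def)
      also have "ennreal \<dots> \<le> ennreal (a t) * (ennreal (B powr \<theta>) + ennreal (B powr (\<theta> - 1)) * P x)"
      proof (cases "u = 0")
        case False
        with u have u0: "0 < u" by simp
        have g: "0 < g"
        proof (rule ccontr)
          assume "\<not> 0 < g"
          with real have "g = 0" by simp
          with ug u0 show False by simp
        qed
        have B: "0 < B" using g \<tau> by (simp add: B_def)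
        have "u powr \<kappa> = u powr (\<kappa> - \<theta>) * u powr \<theta>"
          using u0 by (simp add: powr_add[symmetric])
        also have "\<dots> \<le> ((g / v) * t powr - d) powr (\<kappa> - \<theta>) * (B powr \<theta> + B powr (\<theta> - 1) * u)"
          using \<kappa> u ug B by (intro mult_mono powr_mono2 powr_le_weighted) auto
        also have "((g / v) * t powr - d) powr (\<kappa> - \<theta>) = (g / v) powr (\<kappa> - \<theta>) * t powr (- d * (\<kappa> - \<theta>))"
          using g v by (subst powr_mult) (simp_all add: powr_powr)
        finally have "t powr (d * \<kappa>) * u powr \<kappa> \<le> t powr (d * \<kappa>) *
            ((g / v) powr (\<kappa> - \<theta>) * t powr (- d * (\<kappa> - \<theta>)) * (B powr \<theta> + B powr (\<theta> - 1) * u))"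
          by (intro mult_left_mono) auto
        also have "\<dots> = a t * (B powr \<theta> + B powr (\<theta> - 1) * u)"
        proof -
          have "t powr (d * \<kappa>) * t powr (- d * (\<kappa> - \<theta>)) = t powr (d * \<theta>)"
            by (simp add: powr_add[symmetric] algebra_simps)
          then show ?thesis by (simp add: a_def mult_ac)
        qed
        finally have "ennreal (t powr (d * \<kappa>) * u powr \<kappa>) \<le> ennreal (a t * (B powr \<theta> + B powr (\<theta> - 1) * u))"
          by (rule ennreal_leI)
        also have "\<dots> = ennreal (a t) * (ennreal (B powr \<theta>) + ennreal (B powr (\<theta> - 1)) * ennreal u)"
          using u by (simp add: a_def ennreal_mult)
        also have "\<dots> \<le> ennreal (a t) * (ennreal (B powr \<theta>) + ennreal (B powr (\<theta> - 1)) * P x)"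
          using uP by (intro mult_left_mono add_left_mono) auto
        finally show ?thesis .
      qed simp
      finally show ?thesis .
    qed
    \<comment> \<open>The term \<open>B powr (\<theta> - 1) * P x\<close> has mean at most
      \<open>B powr (\<theta> - 1) * (B / v)\<close>; this is the summand
      \<open>1 / v\<close>.\<close>
    define b where "b = B powr \<theta> * (1 + 1 / v)"
    have b: "0 \<le> b" using v by (simp add: b_def)
    have vol: "emeasure lborel (ball y \<tau>) = ennreal (v * \<tau> powr d)"
      using \<tau> by (simp add: emeasure_ball v_def d_def powr_realpow)
    have vol0: "0 < v * \<tau> powr d" using v \<tau> by simp
    have mean: "mean_value (ball y \<tau>) (\<lambda>x. enn_powr (V t x) q) \<le> ennreal (a t * b)" if t: "0 < t" for t
    proof -
      \<comment> \<open>The indicator is dropped from the second term only: over the whole space the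
        integral of \<open>P\<close> is \<open>g\<close>.\<close>
      have "(\<integral>\<^sup>+x\<in>ball y \<tau>. enn_powr (V t x) q \<partial>lborel)
        \<le> (\<integral>\<^sup>+x. ennreal (a t) * (ennreal (B powr \<theta>) * indicator (ball y \<tau>) x + ennreal (B powr (\<theta> - 1)) * P x) \<partial>lborel)"
      proof (rule nn_integral_mono)
        fix x
        show "enn_powr (V t x) q * indicator (ball y \<tau>) x \<le>
          ennreal (a t) * (ennreal (B powr \<theta>) * indicator (ball y \<tau>) x + ennreal (B powr (\<theta> - 1)) * P x)"
          using Vq[OF t, of x] by (cases "x \<in> ball y \<tau>") (simp_all del: mem_ball)
      qed
      also have "\<dots> = ennreal (a t) * (ennreal (B powr \<theta>) * ennreal (v * \<tau> powr d) + ennreal (B powr (\<theta> - 1)) * ennreal g)"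
      proof -
        have 1: "(\<integral>\<^sup>+x. ennreal (B powr \<theta>) * indicator (ball y \<tau>) x \<partial>lborel) = ennreal (B powr \<theta>) * ennreal (v * \<tau> powr d)"
          unfolding vol[symmetric] by (rule nn_integral_cmult_indicator) simp
        have 2: "(\<integral>\<^sup>+x. ennreal (B powr (\<theta> - 1)) * P x \<partial>lborel) = ennreal (B powr (\<theta> - 1)) * ennreal g"
          by (simp only: nn_integral_cmult[OF P'] real(2))
        have m: "(\<lambda>x. ennreal (B powr \<theta>) * indicator (ball y \<tau>) x) \<in> borel_measurable lborel"
          by (intro borel_measurable_times_ennreal borel_measurable_const borel_measurable_indicator) simp
        have m': "(\<lambda>x. ennreal (B powr (\<theta> - 1)) * P x) \<in> borel_measurable lborel"
          by (intro borel_measurable_times_ennreal borel_measurable_const P')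
        show ?thesis
          by (simp only: nn_integral_cmult[OF borel_measurable_add[OF m m']] nn_integral_add[OF m m'] 1 2)
      qed
      also have "\<dots> = ennreal (a t) * (ennreal (B powr \<theta> * (v * \<tau> powr d)) + ennreal (B powr (\<theta> - 1) * g))"
        using vol0 real by (subst (1 2) ennreal_mult) auto
      also have "\<dots> = ennreal (a t) * ennreal (B powr \<theta> * (v * \<tau> powr d) + B powr (\<theta> - 1) * g)"
        using vol0 real by (subst ennreal_plus) auto
      also have "\<dots> = ennreal (a t * (B powr \<theta> * (v * \<tau> powr d) + B powr (\<theta> - 1) * g))"
        using vol0 real by (subst ennreal_mult) (auto simp: a_def)
      also have "B powr \<theta> * (v * \<tau> powr d) + B powr (\<theta> - 1) * g = b * (v * \<tau> powr d)"
      proof (cases "g = 0")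
        case False
        with real \<tau> have B: "0 < B" by (simp add: B_def)
        have "g = B * \<tau> powr d" using \<tau> by (simp add: B_def)
        then have "B powr (\<theta> - 1) * g = B powr \<theta> * \<tau> powr d"
          using B by (simp add: powr_diff)
        then show ?thesis using v by (simp add: b_def field_simps)
      qed (simp add: B_def b_def)
      finally have le: "(\<integral>\<^sup>+x\<in>ball y \<tau>. enn_powr (V t x) q \<partial>lborel) \<le> ennreal (a t * (b * (v * \<tau> powr d)))" .
      have "emeasure lebesgue (ball y \<tau>) = ennreal (v * \<tau> powr d)"
        using vol by simp
      then have "mean_value (ball y \<tau>) (\<lambda>x. enn_powr (V t x) q)
          \<le> ennreal (a t * (b * (v * \<tau> powr d))) / ennreal (v * \<tau> powr d)"
        unfolding mean_value_def nn_integral_completion by (simp only: divide_right_mono_ennreal[OF le])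
      also have "\<dots> = ennreal (a t * b)"
        using vol0 b by (subst divide_ennreal) (auto simp: a_def)
      finally show ?thesis .
    qed
    have "(\<integral>\<^sup>+t\<in>{0<..<\<tau>}. mean_value (ball y \<tau>) (\<lambda>x. enn_powr (V t x) q) / ennreal t \<partial>lborel)
        \<le> (\<integral>\<^sup>+t. ennreal (b * (g / v) powr (\<kappa> - \<theta>)) * (ennreal (t powr (d * \<theta> - 1)) * indicator {0..\<tau>} t) \<partial>lborel)"
    proof (rule nn_integral_mono)
      fix t :: real
      show "mean_value (ball y \<tau>) (\<lambda>x. enn_powr (V t x) q) / ennreal t * indicator {0<..<\<tau>} t
        \<le> ennreal (b * (g / v) powr (\<kappa> - \<theta>)) * (ennreal (t powr (d * \<theta> - 1)) * indicator {0..\<tau>} t)"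
      proof (cases "t \<in> {0<..<\<tau>}")
        case True
        then have t: "0 < t" "t < \<tau>" by auto
        have "mean_value (ball y \<tau>) (\<lambda>x. enn_powr (V t x) q) / ennreal t \<le> ennreal (a t * b) / ennreal t"
          using mean[OF t(1)] by (rule divide_right_mono_ennreal)
        also have "\<dots> = ennreal (a t * b / t)"
          using t b by (subst divide_ennreal) (auto simp: a_def)
        also have "a t * b / t = b * (g / v) powr (\<kappa> - \<theta>) * t powr (d * \<theta> - 1)"
          using t by (simp add: a_def powr_diff)
        finally show ?thesis using t b by (simp add: ennreal_mult)
      qed simp
    qed
    also have "\<dots> = ennreal (b * (g / v) powr (\<kappa> - \<theta>)) * ennreal (\<tau> powr (d * \<theta>) / (d * \<theta>))"
      using d \<kappa> \<tau> by (subst nn_integral_cmult) (auto simp: nn_integral_powr_from_0)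
    also have "\<dots> = ennreal (b * (g / v) powr (\<kappa> - \<theta>) * (\<tau> powr (d * \<theta>) / (d * \<theta>)))"
      using b d \<kappa> by (intro ennreal_mult[symmetric]) auto
    \<comment> \<open>Since \<open>B powr \<theta>\<close> contains
      \<open>\<tau> powr - (d * \<theta>)\<close>, the radius \<open>\<tau>\<close> cancels.\<close>
    also have "b * (g / v) powr (\<kappa> - \<theta>) * (\<tau> powr (d * \<theta>) / (d * \<theta>)) = L * g powr \<kappa>"
    proof (cases "g = 0")
      case False
      with real have g: "0 < g" by simp
      have "B powr \<theta> * \<tau> powr (d * \<theta>) = g powr \<theta>"
        using g \<tau> by (simp add: B_def powr_divide powr_powr)
      moreover have "(g / v) powr (\<kappa> - \<theta>) = g powr (\<kappa> - \<theta>) * v powr (\<theta> - \<kappa>)"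
        using g v by (simp add: powr_divide powr_diff)
      moreover have "g powr \<theta> * g powr (\<kappa> - \<theta>) = g powr \<kappa>"
        by (simp add: powr_add[symmetric])
      moreover have "b * (g / v) powr (\<kappa> - \<theta>) * (\<tau> powr (d * \<theta>) / (d * \<theta>)) =
         (B powr \<theta> * \<tau> powr (d * \<theta>)) * (g / v) powr (\<kappa> - \<theta>) * ((1 + 1 / v) / (d * \<theta>))"
        by (simp add: b_def)
      ultimately have "b * (g / v) powr (\<kappa> - \<theta>) * (\<tau> powr (d * \<theta>) / (d * \<theta>)) =
         g powr \<kappa> * v powr (\<theta> - \<kappa>) * ((1 + 1 / v) / (d * \<theta>))"
        by (metis mult.assoc)
      then show ?thesis by (simp add: L_def mult_ac)
    qed (simp add: b_def B_def)
    finally have "enn_powr (\<integral>\<^sup>+t\<in>{0<..<\<tau>}. mean_value (ball y \<tau>) (\<lambda>x. enn_powr (V t x) q) / ennreal t \<partial>lborel) (1 / q)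
        \<le> enn_powr (ennreal (L * g powr \<kappa>)) (1 / q)"
      using q by (intro enn_powr_mono) auto
    also have "\<dots> = ennreal ((L * g powr \<kappa>) powr (1 / q))"
      using L by (intro enn_powr_ennreal) auto
    also have "(L * g powr \<kappa>) powr (1 / q) = C * g powr (1 / p0)"
      using L q by (simp add: C_def \<kappa>_def powr_mult powr_powr)
    also have "ennreal (C * g powr (1 / p0)) = ennreal C * enn_powr (\<integral>\<^sup>+x. P x \<partial>lborel) (1 / p0)"
      using C real by (simp add: enn_powr_ennreal ennreal_mult)
    finally show ?thesis .
  qed
  show thesis by (rule that[OF C main])
qed

section \<open>Whitney means\<close>

text \<open>Testing with positive reals \<open>m\<close> above \<open>W\<close> avoids the values 0
  and \<open>top\<close> of a mean: \<open>m\<close> can be raised to negative powers, and the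
  criterion \<open>box_mean_le_iff\<close> asks for a real bound.\<close>

lemma ennreal_le_mult_if_less:
  assumes "0 < C" and le: "\<And>m. 0 < m \<Longrightarrow> W < ennreal m \<Longrightarrow> X \<le> ennreal (C * m)"
  shows "X \<le> ennreal C * W"
proof (rule dense_ge)
  fix z assume z: "ennreal C * W < z"
  show "X \<le> z"
  proof (cases z)
    case (real y)
    have "W \<noteq> top" using z \<open>0 < C\<close> by (auto simp: ennreal_mult_top)
    then obtain w where w: "W = ennreal w" "0 \<le> w" by (cases W) auto
    have "C * w < y"
      using z w real \<open>0 < C\<close> by (simp add: ennreal_less_iff flip: ennreal_mult)
    then have "w < y / C" using \<open>0 < C\<close> by (simp add: field_simps)
    with le[of "y / C"] w real \<open>0 < C\<close> show ?thesis
      by (simp add: ennreal_less_iff)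
  qed simp
qed

lemma esssup_le_iff: "f \<in> borel_measurable M \<Longrightarrow> esssup M f \<le> z \<longleftrightarrow> (AE x in M. f x \<le> z)"
  using esssup_AE[of f M] by (auto intro: esssup_I elim: eventually_mono order_trans)

definition whitney_box :: "real \<Rightarrow> 'a::euclidean_space \<Rightarrow> (real \<times> 'a) set" where
  "whitney_box t x = {t/2..t} \<times> ball x t"

lemma emeasure_lborel_Times:
  assumes "A \<in> sets borel" "B \<in> sets borel"
  shows "emeasure lborel (A \<times> B :: ('a::euclidean_space \<times> 'b::euclidean_space) set)
    = emeasure lborel A * emeasure lborel B"
  unfolding lborel_prod[symmetric] using assms by (intro lborel.emeasure_pair_measure_Times) auto

lemma sets_whitney_box [measurable, simp]: "whitney_box t x \<in> sets borel"
  unfolding whitney_box_def by (rule borel_Times) auto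

lemma emeasure_whitney_box:
  assumes "0 < t"
  shows "emeasure lborel (whitney_box t (x::'a::euclidean_space))
    = ennreal (unit_ball_vol (real DIM('a)) / 2 * t ^ Suc DIM('a))"
  using assms by (simp add: whitney_box_def emeasure_lborel_Times emeasure_ball mult_ac flip: ennreal_mult)

text \<open>
  The Whitney mean of a Borel function as a single average over the product; the boundary slice
  \<open>t/2\<close>, excluded in \<^const>\<open>whitney_mean\<close> for \<open>r = \<infinity>\<close>, is a null set.
\<close>

definition box_mean :: "ennreal \<Rightarrow> (real \<times> 'a::euclidean_space \<Rightarrow> ennreal) \<Rightarrow> real \<Rightarrow> 'a \<Rightarrow> ennreal" where
  "box_mean r h t x =
    (if r = \<infinity> then esssup lborel (\<lambda>p. h p * indicator (whitney_box t x) p)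
     else enn_powr ((\<integral>\<^sup>+p\<in>whitney_box t x. enn_powr (h p) (enn2real r) \<partial>lborel) /
       emeasure lborel (whitney_box t x)) (1 / enn2real r))"

lemma box_mean_infinity_le_iff:
  assumes [measurable]: "h \<in> borel_measurable borel"
  shows "box_mean \<infinity> h t x \<le> z \<longleftrightarrow> (AE p in lborel. p \<in> whitney_box t x \<longrightarrow> h p \<le> z)"
proof -
  have "box_mean \<infinity> h t x \<le> z \<longleftrightarrow> (AE p in lborel. h p * indicator (whitney_box t x) p \<le> z)"
    unfolding box_mean_def by (simp add: esssup_le_iff)
  also have "\<dots> \<longleftrightarrow> (AE p in lborel. p \<in> whitney_box t x \<longrightarrow> h p \<le> z)"
    by (intro AE_cong) (auto split: split_indicator)
  finally show ?thesis .
qed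

lemma ennreal_divide_le_iff_le_mult:
  fixes a b c :: ennreal
  assumes "c \<noteq> 0" "c \<noteq> top"
  shows "a / c \<le> b \<longleftrightarrow> a \<le> b * c"
proof
  assume "a / c \<le> b"
  then have "a / c * c \<le> b * c" by (rule mult_right_mono) simp
  also have "a / c * c = a"
    using assms by (metis ennreal_times_divide mult.commute mult_divide_eq_ennreal)
  finally show "a \<le> b * c" .
next
  assume "a \<le> b * c"
  then show "a / c \<le> b"
    using assms by (intro divide_le_posI_ennreal) (auto simp: mult.commute zero_less_iff_neq_zero)
qed

lemma box_mean_le_iff:
  assumes r: "r \<noteq> \<infinity>" "0 < r" and t: "0 < t" and m: "0 \<le> m"
  shows "box_mean r h t x \<le> ennreal m \<longleftrightarrow>
    (\<integral>\<^sup>+p\<in>whitney_box t x. enn_powr (h p) (enn2real r) \<partial>lborel)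
      \<le> ennreal (m powr enn2real r) * emeasure lborel (whitney_box t x)"
proof -
  have r': "0 < enn2real r" using r by (auto simp: enn2real_positive_iff less_top)
  have v: "emeasure lborel (whitney_box t x) \<noteq> 0" "emeasure lborel (whitney_box t x) \<noteq> top"
    using t less_imp_neq[OF unit_ball_vol_pos[of "real DIM('a)"]]
    by (auto simp: emeasure_whitney_box)
  have "box_mean r h t x \<le> ennreal m \<longleftrightarrow>
    (\<integral>\<^sup>+p\<in>whitney_box t x. enn_powr (h p) (enn2real r) \<partial>lborel) / emeasure lborel (whitney_box t x)
      \<le> ennreal (m powr enn2real r)"
    using r r' m by (simp add: box_mean_def enn_powr_le_iff enn_powr_ennreal)
  also have "\<dots> \<longleftrightarrow> (\<integral>\<^sup>+p\<in>whitney_box t x. enn_powr (h p) (enn2real r) \<partial>lborel)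
      \<le> ennreal (m powr enn2real r) * emeasure lborel (whitney_box t x)"
    using v by (rule ennreal_divide_le_iff_le_mult)
  finally show ?thesis .
qed

text \<open>On the box the weight \<open>fst p powr \<delta>\<close> is at most
  \<open>t powr \<delta>\<close>. For the exponents, \<open>powr_le_weighted\<close> is integrated
  in place of Jensen's inequality; each of its two terms contributes \<open>m powr r\<close>, whence
  \<open>2 powr (1 / r)\<close>.\<close>

lemma box_mean_mono_exponent:
  assumes "0 < r1" "r1 \<le> r0" "0 \<le> \<delta>"
  obtains C :: real where "0 < C"
    "\<And>(h0 :: real \<times> 'a::euclidean_space \<Rightarrow> ennreal) h1 t x.
       h0 \<in> borel_measurable borel \<Longrightarrow> h1 \<in> borel_measurable borel \<Longrightarrow>
       (\<And>p. 0 < fst p \<Longrightarrow> h1 p = ennreal (fst p powr \<delta>) * h0 p) \<Longrightarrow> 0 < t \<Longrightarrow>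
       box_mean r1 h1 t x \<le> ennreal (C * t powr \<delta>) * box_mean r0 h0 t x"
proof -
  have h1_le: "h1 p \<le> ennreal (t powr \<delta>) * h0 p"
    if "\<And>p. 0 < fst p \<Longrightarrow> h1 p = ennreal (fst p powr \<delta>) * h0 p" "0 < t" "p \<in> whitney_box t x"
    for h0 h1 t p and x :: 'a
  proof -
    have "0 < fst p" "fst p \<le> t" using that(2,3) by (auto simp: whitney_box_def)
    then show ?thesis using that(1)[of p] assms
      by (auto intro!: mult_right_mono ennreal_leI powr_mono2)
  qed
  show thesis
  proof (cases "r1 = \<infinity>")
    case True
    then have r0: "r0 = \<infinity>" using assms by (simp add: top_unique)
    show thesis
    proof (rule that[of 1])
      fix h0 h1 :: "real \<times> 'a \<Rightarrow> ennreal" and t :: real and x :: 'a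
      assume [measurable]: "h0 \<in> borel_measurable borel" "h1 \<in> borel_measurable borel"
        and h: "\<And>p. 0 < fst p \<Longrightarrow> h1 p = ennreal (fst p powr \<delta>) * h0 p" and t: "0 < t"
      have "box_mean \<infinity> h0 t x \<le> box_mean \<infinity> h0 t x" ..
      then have "AE p in lborel. p \<in> whitney_box t x \<longrightarrow> h0 p \<le> box_mean \<infinity> h0 t x"
        by (subst (asm) box_mean_infinity_le_iff) auto
      then have "AE p in lborel. p \<in> whitney_box t x \<longrightarrow> h1 p \<le> ennreal (1 * t powr \<delta>) * box_mean \<infinity> h0 t x"
      proof eventually_elim
        case (elim p)
        show ?case
        proof
          assume p: "p \<in> whitney_box t x"
          have "h1 p \<le> ennreal (t powr \<delta>) * h0 p" by (rule h1_le[OF h t p])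
          also have "\<dots> \<le> ennreal (t powr \<delta>) * box_mean \<infinity> h0 t x"
            using elim p by (intro mult_left_mono) auto
          finally show "h1 p \<le> ennreal (1 * t powr \<delta>) * box_mean \<infinity> h0 t x" by simp
        qed
      qed
      then show "box_mean r1 h1 t x \<le> ennreal (1 * t powr \<delta>) * box_mean r0 h0 t x"
        unfolding True r0 by (subst box_mean_infinity_le_iff) auto
    qed simp
  next
    case False
    define r where "r = enn2real r1"
    have r: "0 < r" using False assms by (auto simp: r_def enn2real_positive_iff less_top)
    show thesis
    proof (rule that[of "2 powr (1 / r)"])
      fix h0 h1 :: "real \<times> 'a \<Rightarrow> ennreal" and t :: real and x :: 'a
      assume [measurable]: "h0 \<in> borel_measurable borel" "h1 \<in> borel_measurable borel"
        and h: "\<And>p. 0 < fst p \<Longrightarrow> h1 p = ennreal (fst p powr \<delta>) * h0 p" and t: "0 < t"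
      let ?B = "whitney_box t x"
      show "box_mean r1 h1 t x \<le> ennreal (2 powr (1 / r) * t powr \<delta>) * box_mean r0 h0 t x"
      proof (rule ennreal_le_mult_if_less)
        show "0 < 2 powr (1 / r) * t powr \<delta>" using t by simp
        fix m :: real assume m: "0 < m" "box_mean r0 h0 t x < ennreal m"
        \<comment> \<open>The factor 2 arises for finite \<open>r0\<close>; the case
          \<open>r0 = \<infinity>\<close> is weakened to the same form.\<close>
        have int: "(\<integral>\<^sup>+p\<in>?B. enn_powr (h0 p) r \<partial>lborel) \<le> ennreal (2 * m powr r) * emeasure lborel ?B"
        proof (cases "r0 = \<infinity>")
          case True
          have "box_mean \<infinity> h0 t x \<le> ennreal m" using m True by simp
          then have "AE p in lborel. p \<in> ?B \<longrightarrow> h0 p \<le> ennreal m"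
            by (subst (asm) box_mean_infinity_le_iff) auto
          then have "AE p in lborel. enn_powr (h0 p) r * indicator ?B p \<le> ennreal (2 * m powr r) * indicator ?B p"
          proof eventually_elim
            case (elim p)
            show ?case
            proof (cases "p \<in> ?B")
              case True
              with elim have "enn_powr (h0 p) r \<le> enn_powr (ennreal m) r"
                using r by (intro enn_powr_mono) auto
              also have "\<dots> \<le> ennreal (2 * m powr r)"
                using m by (subst enn_powr_ennreal) (auto intro!: ennreal_leI)
              finally show ?thesis using True by simp
            qed simp
          qed
          then have "(\<integral>\<^sup>+p\<in>?B. enn_powr (h0 p) r \<partial>lborel) \<le> (\<integral>\<^sup>+p. ennreal (2 * m powr r) * indicator ?B p \<partial>lborel)"
            by (rule nn_integral_mono_AE)
          also have "\<dots> = ennreal (2 * m powr r) * emeasure lborel ?B"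
            by (rule nn_integral_cmult_indicator) simp
          finally show ?thesis .
        next
          case False
          define s where "s = enn2real r0"
          have s: "r \<le> s" "0 < s"
            using r assms False by (auto simp: r_def s_def less_top intro: enn2real_mono less_le_trans)
          have "box_mean r0 h0 t x \<le> ennreal m" using m by simp
          then have ints: "(\<integral>\<^sup>+p\<in>?B. enn_powr (h0 p) s \<partial>lborel) \<le> ennreal (m powr s) * emeasure lborel ?B"
            using False s assms t m by (subst (asm) box_mean_le_iff) (auto simp: s_def)
          have young: "enn_powr y r \<le> ennreal (m powr r) + ennreal (m powr (r - s)) * enn_powr y s" for y
          proof (cases y)
            case (real u)
            have eq: "(u powr s) powr (r / s) = u powr r" "(m powr s) powr (r / s) = m powr r"
              "(m powr s) powr (r / s - 1) = m powr (r - s)"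
              using s by (simp_all add: powr_powr right_diff_distrib)
            have "u powr r \<le> m powr r + m powr (r - s) * u powr s"
              using powr_le_weighted[of "r / s" "m powr s" "u powr s"] r s m unfolding eq by simp
            then have "ennreal (u powr r) \<le> ennreal (m powr r + m powr (r - s) * u powr s)"
              by (rule ennreal_leI)
            then show ?thesis
              using real by (simp add: enn_powr_ennreal ennreal_mult)
          next
            case top
            then show ?thesis using m by (simp add: ennreal_mult_top)
          qed
          have "(\<integral>\<^sup>+p\<in>?B. enn_powr (h0 p) r \<partial>lborel) \<le> (\<integral>\<^sup>+p. ennreal (m powr r) * indicator ?B p +
              ennreal (m powr (r - s)) * (enn_powr (h0 p) s * indicator ?B p) \<partial>lborel)"
            by (intro nn_integral_mono) (use young in \<open>auto split: split_indicator\<close>)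
          also have "\<dots> = ennreal (m powr r) * emeasure lborel ?B +
              ennreal (m powr (r - s)) * (\<integral>\<^sup>+p\<in>?B. enn_powr (h0 p) s \<partial>lborel)"
            by (subst nn_integral_add) (auto simp: nn_integral_cmult nn_integral_cmult_indicator)
          also have "\<dots> \<le> ennreal (m powr r) * emeasure lborel ?B +
              ennreal (m powr (r - s)) * (ennreal (m powr s) * emeasure lborel ?B)"
            by (intro add_left_mono mult_left_mono ints) simp
          also have "ennreal (m powr (r - s)) * (ennreal (m powr s) * emeasure lborel ?B)
              = ennreal (m powr r) * emeasure lborel ?B"
            using m by (simp add: mult.assoc[symmetric] ennreal_mult[symmetric] powr_add[symmetric])
          also have "ennreal (m powr r) * emeasure lborel ?B + ennreal (m powr r) * emeasure lborel ?B
              = ennreal (2 * m powr r) * emeasure lborel ?B"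
          proof -
            have "ennreal (2 * m powr r) = ennreal (m powr r) + ennreal (m powr r)"
              by (subst ennreal_plus[symmetric]) auto
            then show ?thesis by (simp only: distrib_right)
          qed
          finally show ?thesis .
        qed
        have "(\<integral>\<^sup>+p\<in>?B. enn_powr (h1 p) r \<partial>lborel)
            \<le> (\<integral>\<^sup>+p. ennreal ((t powr \<delta>) powr r) * (enn_powr (h0 p) r * indicator ?B p) \<partial>lborel)"
        proof (rule nn_integral_mono)
          fix p
          show "enn_powr (h1 p) r * indicator ?B p \<le> ennreal ((t powr \<delta>) powr r) * (enn_powr (h0 p) r * indicator ?B p)"
          proof (cases "p \<in> ?B")
            case True
            have "enn_powr (h1 p) r \<le> enn_powr (ennreal (t powr \<delta>) * h0 p) r"
              using h1_le[OF h t True] r by (intro enn_powr_mono) auto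
            also have "\<dots> = ennreal ((t powr \<delta>) powr r) * enn_powr (h0 p) r"
              by (simp only: enn_powr_mult[OF r] enn_powr_ennreal[OF powr_ge_zero])
            finally show ?thesis using True by simp
          qed simp
        qed
        also have "\<dots> = ennreal ((t powr \<delta>) powr r) * (\<integral>\<^sup>+p\<in>?B. enn_powr (h0 p) r \<partial>lborel)"
          by (rule nn_integral_cmult) simp
        also have "\<dots> \<le> ennreal ((t powr \<delta>) powr r) * (ennreal (2 * m powr r) * emeasure lborel ?B)"
          by (intro mult_left_mono int) simp
        also have "\<dots> = ennreal ((2 powr (1 / r) * t powr \<delta> * m) powr r) * emeasure lborel ?B"
        proof -
          have "(2 powr (1 / r) * t powr \<delta> * m) powr r = (t powr \<delta>) powr r * (2 * m powr r)"
            using r m by (simp add: powr_mult powr_powr)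
          then show ?thesis by (simp add: mult.assoc[symmetric] ennreal_mult)
        qed
        finally show "box_mean r1 h1 t x \<le> ennreal (2 powr (1 / r) * t powr \<delta> * m)"
          using False assms t m by (subst box_mean_le_iff) (auto simp: r_def[symmetric])
      qed
    qed simp
  qed
qed

text \<open>This serves the \<open>esssup\<close> over \<open>t\<close> in target norms with
  \<open>q = \<infinity>\<close>. The boxes are the sections of one Borel set \<open>D\<close>, so
  integrals over them depend measurably on \<open>t\<close> by Tonelli.\<close>

lemma borel_measurable_box_mean:
  fixes h :: "real \<times> 'a::euclidean_space \<Rightarrow> ennreal"
  assumes h [measurable]: "h \<in> borel_measurable borel"
  shows "(\<lambda>t. box_mean r h t x) \<in> borel_measurable (restrict_space borel {0<..})"
proof -
  define D where "D = {q :: real \<times> real \<times> 'a. snd q \<in> whitney_box (fst q) x}"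
  have "closed {q :: real \<times> real \<times> 'a. fst q / 2 \<le> fst (snd q) \<and> fst (snd q) \<le> fst q}"
    by (intro closed_Collect_conj closed_Collect_le continuous_intros) auto
  moreover have "open {q :: real \<times> real \<times> 'a. dist x (snd (snd q)) < fst q}"
    by (intro open_Collect_less continuous_intros)
  moreover have "D = {q. fst q / 2 \<le> fst (snd q) \<and> fst (snd q) \<le> fst q} \<inter> {q. dist x (snd (snd q)) < fst q}"
    by (auto simp: D_def whitney_box_def)
  ultimately have D: "D \<in> sets borel"
    by (simp add: borel_closed borel_open sets.Int)
  have hs: "(\<lambda>q :: real \<times> real \<times> 'a. h (snd q)) \<in> borel_measurable borel"
    by (rule measurable_compose[OF _ h]) (intro borel_measurable_continuous_onI continuous_intros)
  have section_integral: "(\<lambda>t. \<integral>\<^sup>+p. F (t, p) \<partial>lborel) \<in> borel_measurable borel"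
    if "F \<in> borel_measurable borel" for F :: "real \<times> real \<times> 'a \<Rightarrow> ennreal"
  proof (rule lborel.borel_measurable_nn_integral)
    have "sets (borel \<Otimes>\<^sub>M lborel) = sets (borel :: (real \<times> real \<times> 'a) measure)"
      by (metis borel_prod sets_lborel sets_pair_measure_cong)
    with that show "case_prod (\<lambda>t p. F (t, p)) \<in> borel_measurable (borel \<Otimes>\<^sub>M lborel)"
      by (simp cong: measurable_cong_sets)
  qed
  show ?thesis
  proof (cases "r = \<infinity>")
    case True
    show ?thesis
    proof (rule borel_measurableI_le)
      fix z
      \<comment> \<open>The essential supremum is at most \<open>z\<close> iff the part of the box
        where \<open>h\<close> exceeds \<open>z\<close> is null, and this is the vanishing of a
        section integral.\<close>
      have "D \<inter> {q. z < h (snd q)} \<in> sets borel"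
        using borel_measurable_less[OF borel_measurable_const hs, of z] D by (auto simp: pred_def)
      then have "(\<lambda>t. \<integral>\<^sup>+p. indicator (D \<inter> {q. z < h (snd q)}) (t, p) \<partial>lborel) \<in> borel_measurable borel"
        by (intro section_integral) simp
      then have "{t. (\<integral>\<^sup>+p. indicator (D \<inter> {q. z < h (snd q)}) (t, p) \<partial>lborel) = 0} \<in> sets borel"
        by measurable
      also have "{t. (\<integral>\<^sup>+p. indicator (D \<inter> {q. z < h (snd q)}) (t, p) \<partial>lborel) = 0} = {t. box_mean r h t x \<le> z}"
      proof (rule Collect_cong)
        fix t
        have "(\<integral>\<^sup>+p. indicator (D \<inter> {q. z < h (snd q)}) (t, p) \<partial>lborel)
          = (\<integral>\<^sup>+p. indicator (whitney_box t x \<inter> {p. z < h p}) p \<partial>lborel)"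
          by (intro nn_integral_cong) (auto simp: D_def split: split_indicator)
        also have "\<dots> = emeasure lborel (whitney_box t x \<inter> {p. z < h p})"
          using borel_measurable_less[OF borel_measurable_const h, of z]
          by (intro nn_integral_indicator) (auto simp: pred_def)
        also have "whitney_box t x \<inter> {p. z < h p} = {p. p \<in> whitney_box t x \<and> z < h p}" by auto
        finally show "(\<integral>\<^sup>+p. indicator (D \<inter> {q. z < h (snd q)}) (t, p) \<partial>lborel) = 0 \<longleftrightarrow> box_mean r h t x \<le> z"
          unfolding True box_mean_infinity_le_iff[OF h]
          by (subst AE_iff_measurable[OF _ refl]) (auto simp: not_le)
      qed
      finally show "{t \<in> space (restrict_space borel {0<..}). box_mean r h t x \<le> z} \<in> sets (restrict_space borel {0<..})"
        by (auto simp: space_restrict_space sets_restrict_space)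
    qed
  next
    case False
    have "(\<lambda>t. \<integral>\<^sup>+p. enn_powr (h (snd (t, p))) (enn2real r) * indicator D (t, p) \<partial>lborel) \<in> borel_measurable borel"
      by (intro section_integral borel_measurable_times_ennreal borel_measurable_enn_powr hs borel_measurable_indicator D)
    also have "(\<lambda>t. \<integral>\<^sup>+p. enn_powr (h (snd (t, p))) (enn2real r) * indicator D (t, p) \<partial>lborel)
      = (\<lambda>t. \<integral>\<^sup>+p\<in>whitney_box t x. enn_powr (h p) (enn2real r) \<partial>lborel)"
      by (intro ext nn_integral_cong) (auto simp: D_def split: split_indicator)
    finally have [measurable]: "(\<lambda>t. \<integral>\<^sup>+p\<in>whitney_box t x. enn_powr (h p) (enn2real r) \<partial>lborel) \<in> borel_measurable borel" .
    have "(\<lambda>t. enn_powr ((\<integral>\<^sup>+p\<in>whitney_box t x. enn_powr (h p) (enn2real r) \<partial>lborel) /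
       ennreal (unit_ball_vol (real DIM('a)) / 2 * t ^ Suc DIM('a))) (1 / enn2real r)) \<in> borel_measurable borel"
      by measurable
    then have "(\<lambda>t. enn_powr ((\<integral>\<^sup>+p\<in>whitney_box t x. enn_powr (h p) (enn2real r) \<partial>lborel) /
       ennreal (unit_ball_vol (real DIM('a)) / 2 * t ^ Suc DIM('a))) (1 / enn2real r)) \<in> borel_measurable (restrict_space borel {0<..})"
      by (rule measurable_restrict_space1)
    then show ?thesis
      by (rule measurable_cong[THEN iffD1, rotated])
        (use False in \<open>simp add: box_mean_def space_restrict_space emeasure_whitney_box\<close>)
  qed
qed

section \<open>Comparing a Whitney box with neighbouring boxes\<close>

lemma box_mean_cover:
  fixes h :: "real \<times> 'a::euclidean_space \<Rightarrow> ennreal"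
  assumes r: "0 < r" and [measurable]: "h \<in> borel_measurable borel" and t: "0 < t" and m: "0 \<le> m"
    and J: "finite J" "whitney_box t x \<subseteq> (\<Union>j\<in>J. whitney_box (s j) (z j))"
    and s: "\<And>j. j \<in> J \<Longrightarrow> 0 < s j \<and> s j \<le> 4/3 * t"
    and le: "\<And>j. j \<in> J \<Longrightarrow> box_mean r h (s j) (z j) \<le> ennreal m"
  shows "box_mean r h t x \<le>
    ennreal ((if r = \<infinity> then 1 else (real (card J) * (4/3) ^ Suc DIM('a)) powr (1 / enn2real r)) * m)"
proof (cases "r = \<infinity>")
  case True
  have "AE p in lborel. \<forall>j\<in>J. p \<in> whitney_box (s j) (z j) \<longrightarrow> h p \<le> ennreal m"
    using le unfolding True box_mean_infinity_le_iff[OF assms(2)] by (subst AE_finite_all[OF J(1)]) auto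
  then have "AE p in lborel. p \<in> whitney_box t x \<longrightarrow> h p \<le> ennreal m"
    by eventually_elim (use J(2) in auto)
  then have "box_mean r h t x \<le> ennreal m"
    unfolding True box_mean_infinity_le_iff[OF assms(2)] .
  then show ?thesis using True by simp
next
  case False
  define \<rho> where "\<rho> = enn2real r"
  have \<rho>: "0 < \<rho>" using r False by (auto simp: \<rho>_def enn2real_positive_iff less_top)
  define v where "v = unit_ball_vol (real DIM('a)) / 2"
  have v: "0 < v" by (simp add: v_def)
  \<comment> \<open>The integrals over the \<open>card J\<close> covering boxes are added. A box
    with \<open>s j \<le> 4/3 * t\<close> has at most \<open>(4/3) ^ Suc DIM('a)\<close> times the
    volume of the box at \<open>(t, x)\<close>, the extra dimension being that of
    \<open>t\<close>.\<close>
  define c where "c = real (card J) * (4/3) ^ Suc DIM('a)"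
  have c: "0 \<le> c" by (simp add: c_def)
  have int: "(\<integral>\<^sup>+p\<in>whitney_box (s j) (z j). enn_powr (h p) \<rho> \<partial>lborel)
      \<le> ennreal (m powr \<rho> * ((4/3) ^ Suc DIM('a) * (v * t ^ Suc DIM('a))))" if j: "j \<in> J" for j
  proof -
    have sj: "0 < s j" "s j \<le> 4/3 * t" using s[OF j] by auto
    have "(\<integral>\<^sup>+p\<in>whitney_box (s j) (z j). enn_powr (h p) \<rho> \<partial>lborel)
        \<le> ennreal (m powr \<rho>) * emeasure lborel (whitney_box (s j) (z j))"
      using le[OF j] False r sj m by (subst (asm) box_mean_le_iff) (auto simp: \<rho>_def)
    also have "\<dots> = ennreal (m powr \<rho>) * ennreal (v * s j ^ Suc DIM('a))"
      using sj by (simp only: emeasure_whitney_box v_def)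
    also have "\<dots> = ennreal (m powr \<rho> * (v * s j ^ Suc DIM('a)))"
      using v sj by (intro ennreal_mult[symmetric]) auto
    also have "\<dots> \<le> ennreal (m powr \<rho> * ((4/3) ^ Suc DIM('a) * (v * t ^ Suc DIM('a))))"
    proof (intro ennreal_leI mult_left_mono)
      have "v * s j ^ Suc DIM('a) \<le> v * (4/3 * t) ^ Suc DIM('a)"
        using v sj by (intro mult_left_mono power_mono) auto
      also have "\<dots> = (4/3) ^ Suc DIM('a) * (v * t ^ Suc DIM('a))"
        unfolding power_mult_distrib by (simp only: mult.left_commute)
      finally show "v * s j ^ Suc DIM('a) \<le> (4/3) ^ Suc DIM('a) * (v * t ^ Suc DIM('a))" .
    qed simp
    finally show ?thesis .
  qed
  have "(\<integral>\<^sup>+p\<in>whitney_box t x. enn_powr (h p) \<rho> \<partial>lborel)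
      \<le> (\<integral>\<^sup>+p. (\<Sum>j\<in>J. enn_powr (h p) \<rho> * indicator (whitney_box (s j) (z j)) p) \<partial>lborel)"
  proof (rule nn_integral_mono)
    fix p
    show "enn_powr (h p) \<rho> * indicator (whitney_box t x) p
      \<le> (\<Sum>j\<in>J. enn_powr (h p) \<rho> * indicator (whitney_box (s j) (z j)) p)"
    proof (cases "p \<in> whitney_box t x")
      case True
      then obtain j where j: "j \<in> J" "p \<in> whitney_box (s j) (z j)" using J by auto
      then have "enn_powr (h p) \<rho> * indicator (whitney_box t x) p
          \<le> enn_powr (h p) \<rho> * indicator (whitney_box (s j) (z j)) p"
        using True by simp
      also have "\<dots> \<le> (\<Sum>j\<in>J. enn_powr (h p) \<rho> * indicator (whitney_box (s j) (z j)) p)"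
        using J(1) j(1) by (intro member_le_sum) auto
      finally show ?thesis .
    qed simp
  qed
  also have "\<dots> = (\<Sum>j\<in>J. \<integral>\<^sup>+p\<in>whitney_box (s j) (z j). enn_powr (h p) \<rho> \<partial>lborel)"
    by (rule nn_integral_sum) measurable
  also have "\<dots> \<le> (\<Sum>j\<in>J. ennreal (m powr \<rho> * ((4/3) ^ Suc DIM('a) * (v * t ^ Suc DIM('a)))))"
    by (intro sum_mono int)
  also have "\<dots> = ennreal (c * m powr \<rho> * (v * t ^ Suc DIM('a)))"
    using v t by (simp add: c_def ennreal_of_nat_eq_real_of_nat mult_ac flip: ennreal_mult)
  also have "c * m powr \<rho> = (c powr (1 / \<rho>) * m) powr \<rho>"
    using c m \<rho> by (simp add: powr_mult powr_powr)
  also have "ennreal ((c powr (1 / \<rho>) * m) powr \<rho> * (v * t ^ Suc DIM('a)))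
      = ennreal ((c powr (1 / \<rho>) * m) powr \<rho>) * emeasure lborel (whitney_box t x)"
    unfolding emeasure_whitney_box[OF t] v_def[symmetric] using v t by (intro ennreal_mult) auto
  finally have "box_mean r h t x \<le> ennreal (c powr (1 / \<rho>) * m)"
    using False r t m by (subst box_mean_le_iff) (auto simp: \<rho>_def)
  then show ?thesis using False by (simp add: c_def \<rho>_def)
qed

text \<open>
  The box at \<open>(t, x)\<close> is covered by boundedly many pieces \<open>{2/3 * a..a} \<times> ball w (t/4)\<close> with
  \<open>a = 3/4 * t\<close> or \<open>a = t\<close>, each contained in all boxes at \<open>(s, z)\<close> with \<open>a \<le> s \<le> 4/3 * a\<close> and
  \<open>z \<in> ball w (t/4)\<close>. One of the pieces carries a fixed proportion of the mean.
\<close>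

lemma box_mean_local:
  assumes r: "0 < r"
  obtains C :: real where "0 < C"
    "\<And>(h :: real \<times> 'a::euclidean_space \<Rightarrow> ennreal) t x. h \<in> borel_measurable borel \<Longrightarrow> 0 < t \<Longrightarrow>
      \<exists>w\<in>cball x t. \<exists>a>0. \<forall>s\<in>{a..4/3 * a}. \<forall>z\<in>ball w (t/4).
        box_mean r h t x \<le> ennreal C * box_mean r h s z"
proof -
  \<comment> \<open>A finite net of the unit ball; the points \<open>x + t *\<^sub>R e\<close> with
    \<open>e\<close> in \<open>F\<close> become the centres of the pieces.\<close>
  obtain F :: "'a set" where F: "F \<subseteq> cball 0 1" "finite F" "cball 0 1 \<subseteq> (\<Union>e\<in>F. ball e (1/4))"
  proof (rule compactE_image[of "cball (0::'a) 1" "cball 0 1" "\<lambda>e. ball e (1/4)"])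
    show "cball 0 1 \<subseteq> (\<Union>e\<in>cball (0::'a) 1. ball e (1/4))"
      by (auto intro!: bexI)
  qed auto
  define J :: "(real \<times> 'a) set" where "J = {3/4, 1} \<times> F"
  have "0 \<in> cball (0::'a) 1" by simp
  with F have "F \<noteq> {}" by blast
  with F have J: "finite J" "J \<noteq> {}" by (auto simp: J_def)
  define C where "C = (if r = \<infinity> then 1 else (real (card J) * (4/3) ^ Suc DIM('a)) powr (1 / enn2real r))"
  have C: "0 < C" using J by (auto simp: C_def card_gt_0_iff)
  have "\<exists>w\<in>cball x t. \<exists>a>0. \<forall>s\<in>{a..4/3 * a}. \<forall>z\<in>ball w (t/4).
        box_mean r h t x \<le> ennreal C * box_mean r h s z"
    if h: "h \<in> borel_measurable borel" and t: "0 < t" for h t and x :: 'a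
  \<comment> \<open>If no piece worked, each would supply a box whose mean is too small. These
    finitely many boxes cover the one at \<open>(t, x)\<close>, so \<open>box_mean_cover\<close>
    would bound its mean by less than itself.\<close>
  proof (rule ccontr)
    assume neg: "\<not> ?thesis"
    have "\<exists>s z. s \<in> {fst j * t..4/3 * (fst j * t)} \<and> z \<in> ball (x + t *\<^sub>R snd j) (t/4) \<and>
        ennreal C * box_mean r h s z < box_mean r h t x" if "j \<in> J" for j
    proof -
      have "x + t *\<^sub>R snd j \<in> cball x t" "0 < fst j * t"
        using that F t by (auto simp: J_def dist_norm mult_left_le)
      with neg show ?thesis by (meson not_le)
    qed
    then obtain s z where sz: "\<And>j. j \<in> J \<Longrightarrow> s j \<in> {fst j * t..4/3 * (fst j * t)}"
      "\<And>j. j \<in> J \<Longrightarrow> z j \<in> ball (x + t *\<^sub>R snd j) (t/4)"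
      "\<And>j. j \<in> J \<Longrightarrow> ennreal C * box_mean r h (s j) (z j) < box_mean r h t x"
      by metis
    define M where "M = Max ((\<lambda>j. box_mean r h (s j) (z j)) ` J)"
    have M: "box_mean r h (s j) (z j) \<le> M" if "j \<in> J" for j
      unfolding M_def using J that by (intro Max_ge) auto
    have "M \<in> (\<lambda>j. box_mean r h (s j) (z j)) ` J"
      unfolding M_def using J by (intro Max_in) auto
    then have "ennreal C * M < box_mean r h t x" using sz(3) by auto
    \<comment> \<open>The mean at \<open>(t, x)\<close> may be \<open>top\<close>; a value
      \<open>y\<close> strictly below it makes \<open>M\<close> finite and the comparison one of
      real numbers.\<close>
    then obtain y where y: "ennreal C * M < y" "y < box_mean r h t x"
      using dense by blast
    have "y \<noteq> top" using order_less_le_trans[OF y(2) top_greatest] by simp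
    then obtain u where u: "y = ennreal u" "0 \<le> u" by (cases y) auto
    have "ennreal C * M \<noteq> top" using y(1) by (auto simp: top_unique)
    then have "M \<noteq> top" using C by (auto simp: ennreal_mult_top)
    then obtain m where m: "M = ennreal m" "0 \<le> m" by (cases M) auto
    have Cm: "C * m \<le> u" using y(1) u m C by (simp add: ennreal_less_iff flip: ennreal_mult)
    have "box_mean r h t x \<le> ennreal (C * m)"
      unfolding C_def
    proof (rule box_mean_cover[OF r h t m(2) J(1), where s = s and z = z])
      show "whitney_box t x \<subseteq> (\<Union>j\<in>J. whitney_box (s j) (z j))"
      proof
        fix p assume p: "p \<in> whitney_box t x"
        obtain l y where ly: "p = (l, y)" "t/2 \<le> l" "l \<le> t" "dist x y < t"
          using p by (auto simp: whitney_box_def)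
        have "(1/t) *\<^sub>R (y - x) \<in> cball 0 1"
          using ly t by (simp add: dist_norm norm_minus_commute)
        with F(3) have "(1/t) *\<^sub>R (y - x) \<in> (\<Union>e\<in>F. ball e (1/4))" by blast
        then obtain e where e: "e \<in> F" "dist e ((1/t) *\<^sub>R (y - x)) < 1/4" by auto
        \<comment> \<open>For \<open>l \<le> 3/4 * t\<close> the height \<open>s\<close> lies
          between \<open>3/4 * t\<close> and \<open>t\<close>, so
          \<open>s/2 \<le> t/2 \<le> l \<le> s\<close>. Otherwise it lies between \<open>t\<close>
          and \<open>4/3 * t\<close>, so
          \<open>s/2 \<le> 2/3 * t < l \<le> t \<le> s\<close>.\<close>
        define \<alpha> :: real where "\<alpha> = (if l \<le> 3/4 * t then 3/4 else 1)"
        have j: "(\<alpha>, e) \<in> J" using e by (simp add: J_def \<alpha>_def)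
        let ?w = "x + t *\<^sub>R e"
        have "t *\<^sub>R (e - (1/t) *\<^sub>R (y - x)) = ?w - y"
          using t by (simp add: scaleR_diff_right)
        then have "dist ?w y = t * dist e ((1/t) *\<^sub>R (y - x))"
          using t by (metis abs_of_pos dist_norm norm_scaleR)
        with e t have wy: "dist ?w y < t/4" by simp
        have "dist (z (\<alpha>, e)) y \<le> dist ?w (z (\<alpha>, e)) + dist ?w y"
          by (metis dist_commute dist_triangle)
        also have "\<dots> < t/2" using wy sz(2)[OF j] by simp
        also have "t/2 \<le> s (\<alpha>, e)"
          using sz(1)[OF j] t by (auto simp: \<alpha>_def split: if_splits)
        finally have "y \<in> ball (z (\<alpha>, e)) (s (\<alpha>, e))" by simp
        moreover have "l \<in> {s (\<alpha>, e)/2..s (\<alpha>, e)}"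
          using sz(1)[OF j] ly t by (auto simp: \<alpha>_def split: if_splits)
        ultimately have "p \<in> whitney_box (s (\<alpha>, e)) (z (\<alpha>, e))"
          by (simp add: whitney_box_def ly del: mem_ball)
        with j show "p \<in> (\<Union>j\<in>J. whitney_box (s j) (z j))" by blast
      qed
      show "0 < s j \<and> s j \<le> 4/3 * t" if "j \<in> J" for j
        using sz(1)[OF that] that t by (auto simp: J_def)
      show "box_mean r h (s j) (z j) \<le> ennreal m" if "j \<in> J" for j
        using M[OF that] m by simp
    qed
    also have "\<dots> \<le> y" using u Cm by (simp add: ennreal_leI)
    finally show False using y(2) by simp
  qed
  then show thesis using that[OF C] by blast
qed

text \<open>The \<open>dt/t\<close>-mass of \<open>{a..4/3 * a}\<close> is at least its length
  \<open>1/3 * a\<close> divided by its right end \<open>4/3 * a\<close>, which is 1/4 for every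
  \<open>a\<close>; hence \<open>4 powr (1 / r)\<close>. For \<open>q = \<infinity>\<close> positive
  length is enough.\<close>

lemma vertical_ge_local:
  assumes q: "0 < q"
  obtains C :: real where "0 < C"
    "\<And>V a u. 0 < a \<Longrightarrow> (\<And>s. s \<in> {a..4/3 * a} \<Longrightarrow> u \<le> V s) \<Longrightarrow> u \<le> ennreal C * vertical q V"
proof (cases "q = \<infinity>")
  case True
  have "u \<le> ennreal 1 * vertical q V" if a: "0 < a" and u: "\<And>s. s \<in> {a..4/3 * a} \<Longrightarrow> u \<le> V s" for V a u
  proof (rule ccontr)
    assume neg: "\<not> ?thesis"
    have "AE s in lebesgue_on {0<..}. V s \<le> vertical q V"
      using True by (simp add: vertical_def esssup_AE)
    then have "AE s in lebesgue_on {0<..}. s \<notin> {a..4/3 * a}"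
      by eventually_elim (use u neg in force)
    then have "AE s in lebesgue. s \<in> {0<..} \<longrightarrow> s \<notin> {a..4/3 * a}"
      by (subst (asm) AE_restrict_space_iff) auto
    then have "AE s in lborel. s \<notin> {a..4/3 * a}"
      unfolding AE_completion_iff by eventually_elim (use a in auto)
    then have "emeasure lborel {a..4/3 * a} = 0"
      by (subst (asm) AE_iff_measurable[of "{a..4/3 * a}"]) auto
    then show False using a by simp
  qed
  then show ?thesis by (intro that[of 1]) auto
next
  case False
  define r where "r = enn2real q"
  have r: "0 < r" using q False by (auto simp: r_def enn2real_positive_iff less_top)
  have "u \<le> ennreal (4 powr (1 / r)) * vertical q V"
    if a: "0 < a" and u: "\<And>s. s \<in> {a..4/3 * a} \<Longrightarrow> u \<le> V s" for V a u
  proof -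
    let ?I = "\<integral>\<^sup>+t\<in>{0<..}. enn_powr (V t) r / ennreal t \<partial>lborel"
    have "enn_powr u r / ennreal (4/3 * a) * emeasure lborel {a..4/3 * a}
        = (\<integral>\<^sup>+t. enn_powr u r / ennreal (4/3 * a) * indicator {a..4/3 * a} t \<partial>lborel)"
      by (rule nn_integral_cmult_indicator[symmetric]) simp
    also have "\<dots> \<le> ?I"
    proof (rule nn_integral_mono)
      fix t
      show "enn_powr u r / ennreal (4/3 * a) * indicator {a..4/3 * a} t \<le> enn_powr (V t) r / ennreal t * indicator {0<..} t"
      proof (cases "t \<in> {a..4/3 * a}")
        case True
        then have t: "0 < t" "t \<le> 4/3 * a" using a by auto
        have "inverse (ennreal (4/3 * a)) = ennreal (inverse (4/3 * a))" "inverse (ennreal t) = ennreal (inverse t)"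
          using t a by (intro inverse_ennreal; simp)+
        then have "inverse (ennreal (4/3 * a)) \<le> inverse (ennreal t)"
          by (simp only: ennreal_leI[OF le_imp_inverse_le[OF t(2,1)]])
        then have "enn_powr u r / ennreal (4/3 * a) \<le> enn_powr (V t) r / ennreal t"
          using u[OF True] r unfolding divide_ennreal_def by (intro mult_mono enn_powr_mono) auto
        then show ?thesis using True a by simp
      qed simp
    qed
    also have "enn_powr u r / ennreal (4/3 * a) * emeasure lborel {a..4/3 * a} = enn_powr u r * ennreal (1/4)"
    proof -
      have "enn_powr u r / ennreal (4/3 * a) * emeasure lborel {a..4/3 * a} = enn_powr u r / ennreal (4/3 * a) * ennreal (1/3 * a)"
        using a by simp
      also have "\<dots> = enn_powr u r * (ennreal (1/3 * a) / ennreal (4/3 * a))"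
        by (simp add: divide_ennreal_def mult_ac)
      also have "ennreal (1/3 * a) / ennreal (4/3 * a) = ennreal (1/4)"
        using a by (subst divide_ennreal) auto
      finally show ?thesis .
    qed
    finally have "ennreal 4 * (enn_powr u r * ennreal (1/4)) \<le> ennreal 4 * ?I"
      by (rule mult_left_mono) simp
    also have "ennreal 4 * (enn_powr u r * ennreal (1/4)) = enn_powr u r * (ennreal 4 * ennreal (1/4))"
      by (simp only: mult_ac)
    also have "ennreal 4 * ennreal (1/4) = 1"
      by (subst ennreal_mult[symmetric]) auto
    finally have "u \<le> enn_powr (ennreal 4 * ?I) (1 / r)"
      using r by (simp add: enn_powr_le_iff)
    also have "\<dots> = ennreal (4 powr (1 / r)) * enn_powr ?I (1 / r)"
      using r by (subst enn_powr_mult) (auto simp: enn_powr_ennreal simp del: ennreal_numeral)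
    finally show ?thesis
      using False by (simp add: vertical_def nn_integral_completion r_def)
  qed
  then show ?thesis by (intro that[of "4 powr (1 / r)"]) auto
qed

section \<open>From Lebesgue measurable functions to Borel functions on the product\<close>

lemma whitney_weight:
  assumes "0 < s" "ennreal (norm c) = g"
  shows "ennreal (norm (s powr - \<beta> *\<^sub>R c)) = ennreal (s powr - \<beta>) * g"
  using assms by (simp add: ennreal_mult flip: assms(2))

lemma AE_lborel_pairD:
  fixes Q :: "'a::euclidean_space \<times> 'b::euclidean_space \<Rightarrow> bool"
  assumes "AE p in lborel. Q p"
  shows "AE s in lborel. AE y in lborel. Q (s, y)"
  using assms unfolding lborel_prod[symmetric] by (rule lborel_pair.AE_pair)

text \<open>Tonelli turns the iterated mean into a product integral once the modulus of
  \<open>f\<close> is replaced by the Borel function \<open>g\<close>: almost every slice meets the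
  exceptional null set in a null set.\<close>

lemma whitney_mean_eq_box_mean:
  fixes f :: "real \<times> (real^'n::finite) \<Rightarrow> complex"
  assumes f: "f \<in> borel_measurable (lebesgue_on half_space)"
    and g [measurable]: "g \<in> borel_measurable borel"
    and fg: "AE p in lborel. p \<in> half_space \<longrightarrow> ennreal (norm (f p)) = g p"
    and r: "0 < r" and t: "0 < t"
  shows "whitney_mean r \<beta> f t x = box_mean r (\<lambda>p. ennreal (fst p powr - \<beta>) * g p) t x"
proof -
  define h where "h p = ennreal (fst p powr - \<beta>) * g p" for p
  have [measurable]: "fst \<in> borel_measurable (borel :: (real \<times> (real^'n)) measure)"
    by (intro borel_measurable_continuous_onI continuous_intros)
  have h [measurable]: "h \<in> borel_measurable borel"
    unfolding h_def by measurable
  show ?thesis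
  proof (cases "r = \<infinity>")
    case True
    let ?S = "{t/2<..t} \<times> ball x t" and ?F = "\<lambda>(s, y). ennreal (norm (s powr - \<beta> *\<^sub>R f (s, y)))"
    have S: "?S \<in> sets borel" by (intro borel_Times) auto
    have f': "f \<in> borel_measurable (lebesgue_on ?S)"
      using f by (rule measurable_restrict_mono) (use t in \<open>auto simp: half_space_def\<close>)
    have "fst \<in> borel_measurable (lebesgue_on ?S)"
      by (intro measurable_restrict_space1 measurable_completion) simp
    with f' have "(\<lambda>p. ennreal (norm (fst p powr - \<beta> *\<^sub>R f p))) \<in> borel_measurable (lebesgue_on ?S)"
      by measurable
    then have F: "?F \<in> borel_measurable (lebesgue_on ?S)"
      by (simp only: case_prod_beta' prod.collapse)
    have edge: "AE p in lborel. fst (p :: real \<times> (real^'n)) \<noteq> t/2"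
    proof (rule AE_I)
      show "emeasure lborel ({t/2} \<times> UNIV :: (real \<times> (real^'n)) set) = 0"
        by (subst emeasure_lborel_Times) auto
      show "{t/2} \<times> UNIV \<in> sets (lborel :: (real \<times> (real^'n)) measure)"
        by (simp add: borel_Times)
    qed auto
    \<comment> \<open>The two essential suprema live on different measure spaces, so they are
      compared through their upper bounds \<open>z\<close>.\<close>
    have le_iff: "whitney_mean r \<beta> f t x \<le> z \<longleftrightarrow> box_mean r h t x \<le> z" for z
    proof -
      have "whitney_mean r \<beta> f t x \<le> z \<longleftrightarrow> (AE p in lebesgue_on ?S. ?F p \<le> z)"
        using True F by (simp add: whitney_mean_def esssup_le_iff)
      also have "\<dots> \<longleftrightarrow> (AE p in lborel. p \<in> ?S \<longrightarrow> ?F p \<le> z)"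
        using S by (subst AE_restrict_space_iff) (auto simp: AE_completion_iff)
      also have "\<dots> \<longleftrightarrow> (AE p in lborel. p \<in> whitney_box t x \<longrightarrow> h p \<le> z)"
      proof -
        have eq: "AE p in lborel. (p \<in> ?S \<longrightarrow> ?F p \<le> z) \<longleftrightarrow> (p \<in> whitney_box t x \<longrightarrow> h p \<le> z)"
          using fg edge
        proof eventually_elim
          case (elim p)
          have "?F p = h p" if "p \<in> ?S"
            using that elim t whitney_weight[of "fst p" "f p" "g p" \<beta>]
            by (auto simp: half_space_def h_def case_prod_beta)
          moreover have "p \<in> ?S \<longleftrightarrow> p \<in> whitney_box t x"
            using elim by (auto simp: whitney_box_def)
          ultimately show ?case by auto
        qed
        show ?thesis
          using eq by (intro iffI; elim AE_mp; eventually_elim) auto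
      qed
      also have "\<dots> \<longleftrightarrow> box_mean r h t x \<le> z"
        unfolding True box_mean_infinity_le_iff[OF h] ..
      finally show ?thesis .
    qed
    have "whitney_mean r \<beta> f t x = box_mean r h t x"
      using le_iff[of "box_mean r h t x"] le_iff[of "whitney_mean r \<beta> f t x"]
      by (intro order.antisym) simp_all
    then show ?thesis unfolding h_def .
  next
    case False
    define \<rho> where "\<rho> = enn2real r"
    let ?B = "ball x t"
    let ?H = "\<lambda>p. enn_powr (h p) \<rho>"
    have vB: "emeasure lebesgue ?B \<noteq> top" "emeasure lebesgue ?B \<noteq> 0"
      using t less_imp_neq[OF unit_ball_vol_pos[of "real CARD('n)"]] by (auto simp: emeasure_ball)
    have inner: "AE s in lborel. s \<in> {t/2..t} \<longrightarrow>
      mean_value ?B (\<lambda>y. enn_powr (ennreal (norm (s powr - \<beta> *\<^sub>R f (s, y)))) \<rho>)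
        = (\<integral>\<^sup>+y\<in>?B. ?H (s, y) \<partial>lborel) / emeasure lebesgue ?B"
      using AE_lborel_pairD[OF fg]
    proof eventually_elim
      case (elim s)
      show ?case
      proof
        assume "s \<in> {t/2..t}"
        then have s: "0 < s" using t by auto
        have "(\<integral>\<^sup>+y\<in>?B. enn_powr (ennreal (norm (s powr - \<beta> *\<^sub>R f (s, y)))) \<rho> \<partial>lborel) = (\<integral>\<^sup>+y\<in>?B. ?H (s, y) \<partial>lborel)"
        proof (rule nn_integral_cong_AE, use elim in eventually_elim)
          case (elim y)
          then have "ennreal (norm (f (s, y))) = g (s, y)" using s by (simp add: half_space_def)
          from whitney_weight[OF s this, of \<beta>] show ?case by (simp only: h_def fst_conv)
        qed
        then show "mean_value ?B (\<lambda>y. enn_powr (ennreal (norm (s powr - \<beta> *\<^sub>R f (s, y)))) \<rho>)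
          = (\<integral>\<^sup>+y\<in>?B. ?H (s, y) \<partial>lborel) / emeasure lebesgue ?B"
          by (simp add: mean_value_def nn_integral_completion)
      qed
    qed
    have Hbox: "(\<lambda>p. ?H p * indicator (whitney_box t x) p) \<in> borel_measurable (lborel \<Otimes>\<^sub>M lborel)"
      unfolding lborel_prod by measurable
    have "(\<integral>\<^sup>+s\<in>{t/2..t}. mean_value ?B (\<lambda>y. enn_powr (ennreal (norm (s powr - \<beta> *\<^sub>R f (s, y)))) \<rho>) \<partial>lborel)
      = (\<integral>\<^sup>+s. (\<integral>\<^sup>+y. ?H (s, y) * indicator (whitney_box t x) (s, y) \<partial>lborel) / emeasure lebesgue ?B \<partial>lborel)"
    proof (rule nn_integral_cong_AE, use inner in eventually_elim)
      case (elim s)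
      show ?case
      proof (cases "s \<in> {t/2..t}")
        case True
        then have "(\<integral>\<^sup>+y. ?H (s, y) * indicator (whitney_box t x) (s, y) \<partial>lborel) = (\<integral>\<^sup>+y\<in>?B. ?H (s, y) \<partial>lborel)"
          by (intro nn_integral_cong) (auto simp: whitney_box_def split: split_indicator)
        then show ?thesis using True elim by simp
      next
        case False
        then have "(\<integral>\<^sup>+y. ?H (s, y) * indicator (whitney_box t x) (s, y) \<partial>lborel) = (\<integral>\<^sup>+(y :: real^'n). 0 \<partial>lborel)"
          by (intro nn_integral_cong) (auto simp: whitney_box_def split: split_indicator)
        then show ?thesis using False by simp
      qed
    qed
    also have "\<dots> = (\<integral>\<^sup>+s. \<integral>\<^sup>+y. ?H (s, y) * indicator (whitney_box t x) (s, y) \<partial>lborel \<partial>lborel) / emeasure lebesgue ?B"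
      by (intro nn_integral_divide lborel.borel_measurable_nn_integral_fst Hbox)
    also have "(\<integral>\<^sup>+s. \<integral>\<^sup>+y. ?H (s, y) * indicator (whitney_box t x) (s, y) \<partial>lborel \<partial>lborel)
      = (\<integral>\<^sup>+p\<in>whitney_box t x. ?H p \<partial>lborel)"
      by (subst lborel.nn_integral_fst[OF Hbox]) (simp add: lborel_prod)
    finally have "whitney_mean r \<beta> f t x = enn_powr ((\<integral>\<^sup>+p\<in>whitney_box t x. ?H p \<partial>lborel)
        / emeasure lebesgue ?B / emeasure lebesgue {t/2..t}) (1 / \<rho>)"
      using False unfolding whitney_mean_def \<rho>_def[symmetric]
      by (simp add: mean_value_def[of "{t/2..t}"] nn_integral_completion)
    also have "(\<integral>\<^sup>+p\<in>whitney_box t x. ?H p \<partial>lborel) / emeasure lebesgue ?B / emeasure lebesgue {t/2..t}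
      = (\<integral>\<^sup>+p\<in>whitney_box t x. ?H p \<partial>lborel) / emeasure lborel (whitney_box t x)"
    proof -
      have "emeasure lborel (whitney_box t x) = emeasure lebesgue {t/2..t} * emeasure lebesgue ?B"
        by (simp add: whitney_box_def emeasure_lborel_Times)
      moreover have "inverse (emeasure lebesgue {t/2..t} * emeasure lebesgue ?B)
          = inverse (emeasure lebesgue {t/2..t}) * inverse (emeasure lebesgue ?B)"
        using vB t by (intro ennreal_inverse_mult) (auto simp: top.not_eq_extremum)
      ultimately show ?thesis by (simp add: divide_ennreal_def mult_ac)
    qed
    finally show ?thesis
      using False by (simp add: box_mean_def \<rho>_def h_def)
  qed
qed

section \<open>The embedding\<close>

text \<open>For \<open>q = \<infinity>\<close> equality of the limits superior is not enough,
  because the value of \<open>esssup\<close> also depends on whether the function is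
  measurable.\<close>

lemma vertical_cong:
  assumes "\<And>t. 0 < t \<Longrightarrow> V t = W t"
  shows "vertical q V = vertical q W"
proof (cases "q = \<infinity>")
  case True
  have "V \<in> borel_measurable (lebesgue_on {0<..}) \<longleftrightarrow> W \<in> borel_measurable (lebesgue_on {0<..})"
    using assms by (intro measurable_cong) (simp add: space_restrict_space)
  moreover have "Limsup (ae_filter (lebesgue_on {0<..})) V = Limsup (ae_filter (lebesgue_on {0<..})) W"
    using assms by (intro Limsup_eq AE_I2) (simp add: space_restrict_space)
  ultimately show ?thesis using True by (simp add: vertical_def esssup_def)
next
  case False
  have "(\<integral>\<^sup>+t\<in>{0<..}. enn_powr (V t) (enn2real q) / ennreal t \<partial>lebesgue)
      = (\<integral>\<^sup>+t\<in>{0<..}. enn_powr (W t) (enn2real q) / ennreal t \<partial>lebesgue)"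
    using assms by (intro nn_integral_cong) (auto split: split_indicator)
  with False show ?thesis by (simp add: vertical_def)
qed

lemma tent_norm_eq_vertical:
  "p \<noteq> \<infinity> \<Longrightarrow> tent_norm p q r \<beta> f = enn_powr
     (\<integral>\<^sup>+x. enn_powr (vertical q (\<lambda>t. whitney_mean r \<beta> f t x)) (enn2real p) \<partial>lborel) (1 / enn2real p)"
  by (simp add: tent_norm_def vertical_def nn_integral_completion)

text \<open>Only the modulus of \<open>f\<close> enters the norms. Extended by 0 off the half space
  it is Lebesgue measurable, hence almost everywhere equal to a Borel function.\<close>

lemma borel_representative_norm:
  fixes f :: "real \<times> (real^'n::finite) \<Rightarrow> complex"
  assumes f: "f \<in> borel_measurable (lebesgue_on half_space)"
  obtains g :: "real \<times> (real^'n) \<Rightarrow> ennreal" where "g \<in> borel_measurable borel"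
    "AE p in lborel. p \<in> half_space \<longrightarrow> ennreal (norm (f p)) = g p"
proof -
  have "half_space \<in> sets (borel :: (real \<times> (real^'n)) measure)"
    unfolding half_space_def by (intro borel_Times) auto
  then have H: "half_space \<inter> space lebesgue \<in> sets (lebesgue :: (real \<times> (real^'n)) measure)"
    by (simp add: sets_completionI_sets)
  have "(\<lambda>p. ennreal (norm (f p))) \<in> borel_measurable (lebesgue_on half_space)"
    using f by measurable
  then have "(\<lambda>p. ennreal (norm (f p)) * indicator half_space p) \<in> borel_measurable lebesgue"
    by (subst (asm) borel_measurable_restrict_space_iff_ennreal[OF H])
  from completion_ex_borel_measurable[OF this]
  obtain g where g: "g \<in> borel_measurable lborel"
    "AE p in lborel. ennreal (norm (f p)) * indicator half_space p = g p"
    by blast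
  show thesis
  proof (rule that)
    show "AE p in lborel. p \<in> half_space \<longrightarrow> ennreal (norm (f p)) = g p"
      using g(2) by eventually_elim auto
  qed (use g(1) in simp)
qed

text \<open>Meant for the inner functional of the source norm, whose measurability in
  \<open>x\<close> is not established. Simple functions below \<open>ennreal c * f\<close> are
  divided by \<open>c\<close> to give measurable functions below \<open>f\<close>.\<close>

lemma nn_integral_cmult_le:
  assumes c: "0 < c"
  shows "(\<integral>\<^sup>+x. ennreal c * f x \<partial>M) \<le> ennreal c * (\<integral>\<^sup>+x. f x \<partial>M)"
  unfolding nn_integral_def[of M "\<lambda>x. ennreal c * f x"]
proof (rule SUP_least, clarify)
  fix s assume s: "simple_function M s" "s \<le> (\<lambda>x. ennreal c * f x)"
  define s' where "s' x = ennreal (1 / c) * s x" for x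
  have [measurable]: "s' \<in> borel_measurable M"
    unfolding s'_def using borel_measurable_simple_function[OF s(1)] by measurable
  have cancel: "ennreal c * (ennreal (1 / c) * y) = y" "ennreal (1 / c) * (ennreal c * y) = y" for y
    using c by (simp_all add: mult.assoc[symmetric] ennreal_mult[symmetric])
  have s'f: "s' x \<le> f x" for x
    using mult_left_mono[OF le_funD[OF s(2), of x], of "ennreal (1 / c)"] by (simp add: s'_def cancel)
  have "integral\<^sup>S M s = (\<integral>\<^sup>+x. ennreal c * s' x \<partial>M)"
    by (simp add: nn_integral_eq_simple_integral[OF s(1), symmetric] s'_def cancel)
  also have "\<dots> = ennreal c * (\<integral>\<^sup>+x. s' x \<partial>M)"
    by (rule nn_integral_cmult) simp
  also have "\<dots> \<le> ennreal c * (\<integral>\<^sup>+x. f x \<partial>M)"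
    by (intro mult_left_mono nn_integral_mono s'f) simp
  finally show "integral\<^sup>S M s \<le> ennreal c * (\<integral>\<^sup>+x. f x \<partial>M)" .
qed

text \<open>The interface between the source norm and the target estimates. \<open>U\<close> is a
  \<open>p\<close>-th power, so that its majorant is to be integrated to the first power, and it
  absorbs the constant of the exponent change, so that the weighted bound has constant 1.\<close>

lemma tent_space_majorant:
  assumes pos: "0 < p" "0 < q0" "0 < r1" "r1 \<le> r0" "0 \<le> \<beta>0 - \<beta>1"
  obtains C :: real where "0 < C"
    "\<And>f :: real \<times> (real^'n::finite) \<Rightarrow> complex. f \<in> borel_measurable (lebesgue_on half_space) \<Longrightarrow>
      \<exists>U P. P \<in> borel_measurable borel \<and>
        (\<forall>t>0. \<forall>x. \<forall>z\<in>ball x t. U t x \<le> P z) \<and>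
        (\<forall>t>0. \<forall>x. whitney_mean r1 \<beta>1 f t x \<le> ennreal (t powr (\<beta>0 - \<beta>1)) * enn_powr (U t x) (1 / p)) \<and>
        (\<forall>x. (\<lambda>t. whitney_mean r1 \<beta>1 f t x) \<in> borel_measurable (lebesgue_on {0<..})) \<and>
        enn_powr (\<integral>\<^sup>+x. P x \<partial>lborel) (1 / p) \<le> ennreal C * tent_norm (ennreal p) q0 r0 \<beta>0 f"
proof -
  have r0: "0 < r0" using pos by auto
  obtain C1 where C1: "0 < C1" and local: "\<And>(h :: real \<times> (real^'n) \<Rightarrow> ennreal) t x. h \<in> borel_measurable borel \<Longrightarrow> 0 < t \<Longrightarrow>
      \<exists>w\<in>cball x t. \<exists>a>0. \<forall>s\<in>{a..4/3 * a}. \<forall>z\<in>ball w (t/4).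
        box_mean r0 h t x \<le> ennreal C1 * box_mean r0 h s z"
    using box_mean_local[OF r0] by metis
  obtain C2 where C2: "0 < C2" and vert: "\<And>V a u. 0 < a \<Longrightarrow> (\<And>s. s \<in> {a..4/3 * a} \<Longrightarrow> u \<le> V s) \<Longrightarrow>
      u \<le> ennreal C2 * vertical q0 V"
    using vertical_ge_local[OF pos(2)] by metis
  obtain C3 where C3: "0 < C3" and expo:
    "\<And>(h0 :: real \<times> (real^'n) \<Rightarrow> ennreal) h1 t x.
       h0 \<in> borel_measurable borel \<Longrightarrow> h1 \<in> borel_measurable borel \<Longrightarrow>
       (\<And>p. 0 < fst p \<Longrightarrow> h1 p = ennreal (fst p powr (\<beta>0 - \<beta>1)) * h0 p) \<Longrightarrow> 0 < t \<Longrightarrow>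
       box_mean r1 h1 t x \<le> ennreal (C3 * t powr (\<beta>0 - \<beta>1)) * box_mean r0 h0 t x"
    using box_mean_mono_exponent[OF pos(3-5)] by metis
  \<comment> \<open>The factors come from lowering the exponent, from passing to the nearby boxes
    and from bounding an interval by the functional in \<open>t\<close>.\<close>
  define K where "K = C3 * C1 * C2"
  define L :: real where "L = 25 ^ CARD('n)"
  have K: "0 < K" using C1 C2 C3 by (simp add: K_def)
  have L: "0 < L" by (simp add: L_def)
  have "\<exists>U P. P \<in> borel_measurable borel \<and>
        (\<forall>t>0. \<forall>x. \<forall>z\<in>ball x t. U t x \<le> P z) \<and>
        (\<forall>t>0. \<forall>x. whitney_mean r1 \<beta>1 f t x \<le> ennreal (t powr (\<beta>0 - \<beta>1)) * enn_powr (U t x) (1 / p)) \<and>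
        (\<forall>x. (\<lambda>t. whitney_mean r1 \<beta>1 f t x) \<in> borel_measurable (lebesgue_on {0<..})) \<and>
        enn_powr (\<integral>\<^sup>+x. P x \<partial>lborel) (1 / p) \<le> ennreal (L powr (1 / p) * K) * tent_norm (ennreal p) q0 r0 \<beta>0 f"
    if f: "f \<in> borel_measurable (lebesgue_on half_space)" for f :: "real \<times> (real^'n) \<Rightarrow> complex"
  proof -
    obtain g :: "real \<times> (real^'n) \<Rightarrow> ennreal" where g [measurable]: "g \<in> borel_measurable borel"
      and fg: "AE p in lborel. p \<in> half_space \<longrightarrow> ennreal (norm (f p)) = g p"
      using borel_representative_norm[OF f] by blast
    have [measurable]: "fst \<in> borel_measurable (borel :: (real \<times> (real^'n)) measure)"
      by (intro borel_measurable_continuous_onI continuous_intros)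
    define h where "h \<beta> p = ennreal (fst p powr - \<beta>) * g p" for \<beta> p
    have h: "h \<beta> \<in> borel_measurable borel" for \<beta>
      unfolding h_def by measurable
    have W: "whitney_mean r \<beta> f t x = box_mean r (h \<beta>) t x" if "0 < r" "0 < t" for r \<beta> t x
      unfolding h_def by (rule whitney_mean_eq_box_mean[OF f g fg that])
    have hh: "h \<beta>1 p = ennreal (fst p powr (\<beta>0 - \<beta>1)) * h \<beta>0 p" if "0 < fst p" for p
      by (simp add: h_def mult.assoc[symmetric] ennreal_mult[symmetric] powr_add[symmetric])
    define U where "U t x = enn_powr (ennreal C3 * box_mean r0 (h \<beta>0) t x) p" for t x
    define v where "v z = vertical q0 (\<lambda>s. box_mean r0 (h \<beta>0) s z)" for z
    define N where "N z = enn_powr (ennreal K * v z) p" for z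
    have "\<exists>w\<in>cball x t. \<forall>z\<in>ball w (t/4). U t x \<le> N z" if t: "0 < t" for t x
    proof -
      obtain w a where wa: "w \<in> cball x t" "0 < a" and le: "\<And>s z. s \<in> {a..4/3 * a} \<Longrightarrow> z \<in> ball w (t/4) \<Longrightarrow>
          box_mean r0 (h \<beta>0) t x \<le> ennreal C1 * box_mean r0 (h \<beta>0) s z"
        using local[OF h t] by blast
      have "U t x \<le> N z" if z: "z \<in> ball w (t/4)" for z
      proof -
        \<comment> \<open>\<open>C1\<close> moves to the left because \<open>vert\<close> compares
          one fixed value with the unscaled function of \<open>s\<close>.\<close>
        have "ennreal (1 / C1) * box_mean r0 (h \<beta>0) t x \<le> box_mean r0 (h \<beta>0) s z" if s: "s \<in> {a..4/3 * a}" for s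
        proof -
          have "ennreal (1 / C1) * box_mean r0 (h \<beta>0) t x \<le> ennreal (1 / C1) * (ennreal C1 * box_mean r0 (h \<beta>0) s z)"
            by (intro mult_left_mono le s z) simp
          also have "\<dots> = box_mean r0 (h \<beta>0) s z"
            using C1 by (simp add: mult.assoc[symmetric] ennreal_mult[symmetric])
          finally show ?thesis .
        qed
        then have "ennreal (1 / C1) * box_mean r0 (h \<beta>0) t x \<le> ennreal C2 * v z"
          unfolding v_def by (intro vert[OF wa(2)])
        then have "ennreal (C3 * C1) * (ennreal (1 / C1) * box_mean r0 (h \<beta>0) t x) \<le> ennreal (C3 * C1) * (ennreal C2 * v z)"
          by (rule mult_left_mono) simp
        then have "ennreal C3 * box_mean r0 (h \<beta>0) t x \<le> ennreal K * v z"
          using C1 C2 C3 by (simp add: mult.assoc[symmetric] ennreal_mult[symmetric] K_def)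
        then show ?thesis
          unfolding U_def N_def using pos by (intro enn_powr_mono) auto
      qed
      with wa show ?thesis by blast
    qed
    from nontangential_majorant[where U = U and N = N, OF this]
    obtain P where P: "P \<in> borel_measurable borel"
      and UP: "\<And>t x z. 0 < t \<Longrightarrow> z \<in> ball x t \<Longrightarrow> U t x \<le> P z"
      and PN: "(\<integral>\<^sup>+x. P x \<partial>lborel) \<le> ennreal L * (\<integral>\<^sup>+x. N x \<partial>lborel)"
      by (auto simp: L_def simp del: mem_ball)
    have "whitney_mean r1 \<beta>1 f t x \<le> ennreal (t powr (\<beta>0 - \<beta>1)) * enn_powr (U t x) (1 / p)" if t: "0 < t" for t x
    proof -
      have "whitney_mean r1 \<beta>1 f t x \<le> ennreal (C3 * t powr (\<beta>0 - \<beta>1)) * box_mean r0 (h \<beta>0) t x"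
        unfolding W[OF pos(3) t] using expo[OF h h hh t] by blast
      also have "\<dots> = ennreal (t powr (\<beta>0 - \<beta>1)) * (ennreal C3 * box_mean r0 (h \<beta>0) t x)"
        using C3 by (simp add: ennreal_mult mult_ac)
      also have "ennreal C3 * box_mean r0 (h \<beta>0) t x = enn_powr (U t x) (1 / p)"
        using pos by (simp add: U_def enn_powr_powr)
      finally show ?thesis .
    qed
    moreover have "(\<lambda>t. whitney_mean r1 \<beta>1 f t x) \<in> borel_measurable (lebesgue_on {0<..})" for x
    proof -
      have "(\<lambda>t. box_mean r1 (h \<beta>1) t x * indicator {0<..} t) \<in> borel_measurable borel"
        using borel_measurable_box_mean[OF h, of r1 \<beta>1 x]
        by (subst (asm) borel_measurable_restrict_space_iff_ennreal) auto
      then have "(\<lambda>t. box_mean r1 (h \<beta>1) t x * indicator {0<..} t) \<in> borel_measurable lebesgue"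
        by (intro measurable_completion) simp
      then have "(\<lambda>t. box_mean r1 (h \<beta>1) t x) \<in> borel_measurable (lebesgue_on {0<..})"
        by (subst borel_measurable_restrict_space_iff_ennreal) auto
      then show ?thesis
        by (rule measurable_cong[THEN iffD1, rotated]) (simp add: W pos space_restrict_space)
    qed
    moreover have "enn_powr (\<integral>\<^sup>+x. P x \<partial>lborel) (1 / p) \<le> ennreal (L powr (1 / p) * K) * tent_norm (ennreal p) q0 r0 \<beta>0 f"
    proof -
      let ?I = "\<integral>\<^sup>+x. enn_powr (v x) p \<partial>lborel"
      have tent: "tent_norm (ennreal p) q0 r0 \<beta>0 f = enn_powr ?I (1 / p)"
        using pos by (simp add: tent_norm_eq_vertical v_def W[OF r0] cong: vertical_cong)
      have "(\<integral>\<^sup>+x. N x \<partial>lborel) = (\<integral>\<^sup>+x. ennreal (K powr p) * enn_powr (v x) p \<partial>lborel)"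
        using pos K by (simp add: N_def enn_powr_mult enn_powr_ennreal)
      also have "\<dots> \<le> ennreal (K powr p) * ?I"
        using K by (intro nn_integral_cmult_le) simp
      finally have "(\<integral>\<^sup>+x. P x \<partial>lborel) \<le> ennreal L * (ennreal (K powr p) * ?I)"
        using PN by (elim order_trans) (rule mult_left_mono, simp_all)
      then have "enn_powr (\<integral>\<^sup>+x. P x \<partial>lborel) (1 / p) \<le> enn_powr (ennreal L * (ennreal (K powr p) * ?I)) (1 / p)"
        using pos by (intro enn_powr_mono) auto
      also have "\<dots> = ennreal (L powr (1 / p)) * (ennreal K * enn_powr ?I (1 / p))"
        using pos K L by (simp add: enn_powr_mult enn_powr_ennreal powr_powr)
      also have "\<dots> = ennreal (L powr (1 / p) * K) * tent_norm (ennreal p) q0 r0 \<beta>0 f"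
        using K by (simp add: tent ennreal_mult mult_ac)
      finally show ?thesis .
    qed
    ultimately show ?thesis using P UP by blast
  qed
  then show thesis using that[of "L powr (1 / p) * K"] K L by simp
qed

lemma enn2real_of_nat_divide:
  assumes "0 < p" "p \<noteq> \<infinity>"
  shows "enn2real (of_nat n / p) = real n / enn2real p"
  using assms
  by (cases p) (auto simp: ennreal_of_nat_eq_real_of_nat divide_ennreal)

theorem theorem3p19:
  fixes p0 p1 q0 q1 r0 r1 :: ennreal and \<beta>0 \<beta>1 :: real
  assumes "0 < p0" and "p0 < p1"
    and "0 < q0" and "0 < q1"
    and "0 < r1" and "r1 \<le> r0"
    and "\<beta>0 - \<beta>1 = enn2real (of_nat CARD('n) / p0) - enn2real (of_nat CARD('n) / p1)"
  shows "(tent_space p0 q0 r0 \<beta>0 :: (real \<times> (real^'n::finite) \<Rightarrow> complex) set)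
            \<subseteq> tent_space p1 q1 r1 \<beta>1 \<and>
         (\<exists>C::real. \<forall>f \<in> (tent_space p0 q0 r0 \<beta>0 :: (real \<times> (real^'n) \<Rightarrow> complex) set).
            tent_norm p1 q1 r1 \<beta>1 f \<le> ennreal C * tent_norm p0 q0 r0 \<beta>0 f)"
proof -
  let ?d = "real CARD('n)"
  have "p0 < top" using assms(2) by (rule less_le_trans) simp
  define p where "p = enn2real p0"
  have p: "0 < p" "p0 = ennreal p"
    using assms(1) \<open>p0 < top\<close> by (auto simp: p_def enn2real_positive_iff)
  define \<delta> where "\<delta> = \<beta>0 - \<beta>1"
  \<comment> \<open>The decay exponent, equal to 0 exactly for
    \<open>p1 = \<infinity>\<close>.\<close>
  define e where "e = (if p1 = \<infinity> then 0 else ?d / enn2real p1)"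
  have \<delta>: "\<delta> = ?d / p - e"
    using assms(1,2,7) \<open>p0 < top\<close>
    by (auto simp: \<delta>_def e_def p_def enn2real_of_nat_divide less_top)
  have p1: "p < enn2real p1" if "p1 \<noteq> \<infinity>"
    using that assms(2) p by (cases p1) (auto simp: ennreal_less_iff)
  have \<delta>_pos: "0 < \<delta>"
    using p p1 by (auto simp: \<delta> e_def intro!: divide_strict_left_mono)
  obtain C0 where C0: "0 < C0" and majorant:
    "\<And>f :: real \<times> (real^'n) \<Rightarrow> complex. f \<in> borel_measurable (lebesgue_on half_space) \<Longrightarrow>
      \<exists>U P. P \<in> borel_measurable borel \<and>
        (\<forall>t>0. \<forall>x. \<forall>z\<in>ball x t. U t x \<le> P z) \<and>
        (\<forall>t>0. \<forall>x. whitney_mean r1 \<beta>1 f t x \<le> ennreal (t powr \<delta>) * enn_powr (U t x) (1 / p)) \<and>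
        (\<forall>x. (\<lambda>t. whitney_mean r1 \<beta>1 f t x) \<in> borel_measurable (lebesgue_on {0<..})) \<and>
        enn_powr (\<integral>\<^sup>+x. P x \<partial>lborel) (1 / p) \<le> ennreal C0 * tent_norm p0 q0 r0 \<beta>0 f"
    unfolding p(2) \<delta>_def
    using tent_space_majorant[where 'n = 'n, OF p(1) assms(3,5,6), of \<beta>0 \<beta>1] \<delta>_pos
    unfolding \<delta>_def by (metis less_imp_le)
  \<comment> \<open>The constant must precede \<open>U\<close>, \<open>P\<close> and
    \<open>f\<close>; this common form collects the three shapes of the target norm:
    \<open>p1\<close> finite, \<open>p1 = q1 = \<infinity>\<close>, and
    \<open>p1 = \<infinity>\<close> with \<open>q1\<close> finite.\<close>
  have "\<exists>C>0. \<forall>(U :: real \<Rightarrow> real^'n \<Rightarrow> ennreal) P f. P \<in> borel_measurable borel \<longrightarrow>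
        (\<forall>t>0. \<forall>x. \<forall>z\<in>ball x t. U t x \<le> P z) \<longrightarrow>
        (\<forall>t>0. \<forall>x. whitney_mean r1 \<beta>1 f t x \<le> ennreal (t powr \<delta>) * enn_powr (U t x) (1 / p)) \<longrightarrow>
        (\<forall>x. (\<lambda>t. whitney_mean r1 \<beta>1 f t x) \<in> borel_measurable (lebesgue_on {0<..})) \<longrightarrow>
        tent_norm p1 q1 r1 \<beta>1 f \<le> ennreal C * enn_powr (\<integral>\<^sup>+x. P x \<partial>lborel) (1 / p)"
  proof (cases "p1 = \<infinity>")
    case False
    with p1 p have "0 < enn2real p1" by auto
    moreover have "\<delta> = real DIM(real^'n) / p - real DIM(real^'n) / enn2real p1"
      using False by (simp add: \<delta> e_def)
    ultimately obtain C where C: "0 < C" and bound: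
      "\<And>(U :: real \<Rightarrow> real^'n \<Rightarrow> ennreal) V P. P \<in> borel_measurable borel \<Longrightarrow>
       (\<And>t x z. 0 < t \<Longrightarrow> z \<in> ball x t \<Longrightarrow> U t x \<le> P z) \<Longrightarrow>
       (\<And>t x. 0 < t \<Longrightarrow> V t x \<le> ennreal (t powr \<delta>) * enn_powr (U t x) (1 / p)) \<Longrightarrow>
       (\<And>x. q1 = \<infinity> \<Longrightarrow> (\<lambda>t. V t x) \<in> borel_measurable (lebesgue_on {0<..})) \<Longrightarrow>
       enn_powr (\<integral>\<^sup>+x. enn_powr (vertical q1 (\<lambda>t. V t x)) (enn2real p1) \<partial>lborel) (1 / enn2real p1)
         \<le> ennreal C * enn_powr (\<integral>\<^sup>+x. P x \<partial>lborel) (1 / p)"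
      using vertical_Lp_bound[OF \<delta>_pos p(1) _ assms(4)] by metis
    have "tent_norm p1 q1 r1 \<beta>1 f \<le> ennreal C * enn_powr (\<integral>\<^sup>+x. P x \<partial>lborel) (1 / p)"
      if P: "P \<in> borel_measurable borel" and U: "\<forall>t>0. \<forall>x. \<forall>z\<in>ball x t. U t x \<le> P z"
        and V: "\<forall>t>0. \<forall>x. whitney_mean r1 \<beta>1 f t x \<le> ennreal (t powr \<delta>) * enn_powr (U t x) (1 / p)"
        and meas: "\<forall>x. (\<lambda>t. whitney_mean r1 \<beta>1 f t x) \<in> borel_measurable (lebesgue_on {0<..})"
      for U :: "real \<Rightarrow> real^'n \<Rightarrow> ennreal" and P f
      unfolding tent_norm_eq_vertical[OF False] using U V meas by (intro bound[OF P, of U]) auto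
    with C show ?thesis by blast
  next
    case True
    then have \<delta>_eq: "\<delta> = real DIM(real^'n) / p" by (simp add: \<delta> e_def)
    show ?thesis
    proof (cases "q1 = \<infinity>")
      case q1: True
      let ?C = "unit_ball_vol (real DIM(real^'n)) powr - (1 / p)"
      have "tent_norm p1 q1 r1 \<beta>1 f \<le> ennreal ?C * enn_powr (\<integral>\<^sup>+x. P x \<partial>lborel) (1 / p)"
        if P: "P \<in> borel_measurable borel" and U: "\<forall>t>0. \<forall>x. \<forall>z\<in>ball x t. U t x \<le> P z"
          and V: "\<forall>t>0. \<forall>x. whitney_mean r1 \<beta>1 f t x \<le> ennreal (t powr \<delta>) * enn_powr (U t x) (1 / p)"
        for U :: "real \<Rightarrow> real^'n \<Rightarrow> ennreal" and P f
      proof -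
        have "whitney_mean r1 \<beta>1 f t x \<le> ennreal ?C * enn_powr (\<integral>\<^sup>+x. P x \<partial>lborel) (1 / p)" if "0 < t" for t x
          using U V that unfolding \<delta>_eq by (intro sup_bound[OF p(1) P, of U]) auto
        then show ?thesis
          using True q1 by (auto simp: tent_norm_def intro!: SUP_least)
      qed
      moreover have "0 < ?C"
        using unit_ball_vol_pos[of "real DIM(real^'n)"] by (simp del: unit_ball_vol_pos)
      ultimately show ?thesis by blast
    next
      case False
      define q where "q = enn2real q1"
      have q: "0 < q" using False assms(4) by (auto simp: q_def enn2real_positive_iff less_top)
      show ?thesis
      proof (rule carleson_bound[where 'a = "real^'n", OF p(1) q])
        fix C :: real assume C: "0 < C" and bound:
          "\<And>(U :: real \<Rightarrow> real^'n \<Rightarrow> ennreal) V P \<tau> y. P \<in> borel_measurable borel \<Longrightarrow>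
           (\<And>t x z. 0 < t \<Longrightarrow> z \<in> ball x t \<Longrightarrow> U t x \<le> P z) \<Longrightarrow>
           (\<And>t x. 0 < t \<Longrightarrow> V t x \<le> ennreal (t powr (real DIM(real^'n) / p)) * enn_powr (U t x) (1 / p)) \<Longrightarrow>
           0 < \<tau> \<Longrightarrow>
           enn_powr (\<integral>\<^sup>+t\<in>{0<..<\<tau>}. mean_value (ball y \<tau>) (\<lambda>x. enn_powr (V t x) q) / ennreal t \<partial>lborel) (1 / q)
             \<le> ennreal C * enn_powr (\<integral>\<^sup>+x. P x \<partial>lborel) (1 / p)"
        have "tent_norm p1 q1 r1 \<beta>1 f \<le> ennreal C * enn_powr (\<integral>\<^sup>+x. P x \<partial>lborel) (1 / p)"
          if P: "P \<in> borel_measurable borel" and U: "\<forall>t>0. \<forall>x. \<forall>z\<in>ball x t. U t x \<le> P z"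
            and V: "\<forall>t>0. \<forall>x. whitney_mean r1 \<beta>1 f t x \<le> ennreal (t powr \<delta>) * enn_powr (U t x) (1 / p)"
          for U :: "real \<Rightarrow> real^'n \<Rightarrow> ennreal" and P f
        proof -
          have "enn_powr (\<integral>\<^sup>+t\<in>{0<..<\<tau>}. mean_value (ball y \<tau>) (\<lambda>x. enn_powr (whitney_mean r1 \<beta>1 f t x) q) / ennreal t \<partial>lborel) (1 / q)
             \<le> ennreal C * enn_powr (\<integral>\<^sup>+x. P x \<partial>lborel) (1 / p)" if "0 < \<tau>" for \<tau> y
            using U V that unfolding \<delta>_eq by (intro bound[OF P, of U]) auto
          then show ?thesis
            using True False by (auto simp: tent_norm_def nn_integral_completion q_def intro!: SUP_least)
        qed
        with C show ?thesis by blast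
      qed
    qed
  qed
  then obtain C1 where C1: "0 < C1" and embed: "\<And>(U :: real \<Rightarrow> real^'n \<Rightarrow> ennreal) P f. P \<in> borel_measurable borel \<Longrightarrow>
        \<forall>t>0. \<forall>x. \<forall>z\<in>ball x t. U t x \<le> P z \<Longrightarrow>
        \<forall>t>0. \<forall>x. whitney_mean r1 \<beta>1 f t x \<le> ennreal (t powr \<delta>) * enn_powr (U t x) (1 / p) \<Longrightarrow>
        \<forall>x. (\<lambda>t. whitney_mean r1 \<beta>1 f t x) \<in> borel_measurable (lebesgue_on {0<..}) \<Longrightarrow>
        tent_norm p1 q1 r1 \<beta>1 f \<le> ennreal C1 * enn_powr (\<integral>\<^sup>+x. P x \<partial>lborel) (1 / p)"
    by blast
  \<comment> \<open>Shown for every measurable \<open>f\<close>, also of infinite norm; membership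
    in the target space is then finiteness of the right-hand side.\<close>
  have bound: "tent_norm p1 q1 r1 \<beta>1 f \<le> ennreal (C1 * C0) * tent_norm p0 q0 r0 \<beta>0 f"
    if f: "f \<in> borel_measurable (lebesgue_on half_space)" for f :: "real \<times> (real^'n) \<Rightarrow> complex"
  proof -
    obtain U P where P: "P \<in> borel_measurable borel" "\<forall>t>0. \<forall>x. \<forall>z\<in>ball x t. U t x \<le> P z"
        "\<forall>t>0. \<forall>x. whitney_mean r1 \<beta>1 f t x \<le> ennreal (t powr \<delta>) * enn_powr (U t x) (1 / p)"
        "\<forall>x. (\<lambda>t. whitney_mean r1 \<beta>1 f t x) \<in> borel_measurable (lebesgue_on {0<..})"
      and le: "enn_powr (\<integral>\<^sup>+x. P x \<partial>lborel) (1 / p) \<le> ennreal C0 * tent_norm p0 q0 r0 \<beta>0 f"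
      using majorant[OF f] by blast
    have "tent_norm p1 q1 r1 \<beta>1 f \<le> ennreal C1 * enn_powr (\<integral>\<^sup>+x. P x \<partial>lborel) (1 / p)"
      by (rule embed[OF P])
    also have "\<dots> \<le> ennreal C1 * (ennreal C0 * tent_norm p0 q0 r0 \<beta>0 f)"
      by (intro mult_left_mono le) simp
    also have "\<dots> = ennreal (C1 * C0) * tent_norm p0 q0 r0 \<beta>0 f"
      using C0 C1 by (simp add: ennreal_mult mult.assoc)
    finally show ?thesis .
  qed
  show ?thesis
  proof (intro conjI subsetI exI ballI)
    fix f :: "real \<times> (real^'n) \<Rightarrow> complex" assume f: "f \<in> tent_space p0 q0 r0 \<beta>0"
    then show "tent_norm p1 q1 r1 \<beta>1 f \<le> ennreal (C1 * C0) * tent_norm p0 q0 r0 \<beta>0 f"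
      by (intro bound) (simp add: tent_space_def)
    also have "\<dots> < \<infinity>"
      using f by (simp add: tent_space_def ennreal_mult_less_top)
    finally show "f \<in> tent_space p1 q1 r1 \<beta>1"
      using f by (simp add: tent_space_def)
  qed
qed

end
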